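(* Let $G$ be a GVZ-group with two character degrees and let $\chi \in nl(G)$. Let $$Irr_{*}(Z(\chi)/[Z(\chi),G])=\{\lambda \in Irr(Z(\chi)) : [Z(\chi),G] \subseteq \ker\lambda,\ G' \not\subseteq \ker\lambda\}.$$ Then: (i) $|\{\phi \in nl(G): Z(\phi)=Z(\chi)\}| = |Z(\chi)|\left(\frac{1}{|[Z(\chi),G]|}-\frac{1}{|G'|}\right)$. (ii) If $\lambda \in Irr_{*}(Z(\chi)/[Z(\chi),G])$, then the induced character $\lambda^{G}$ has a unique non-linear irreducible character of $G$ as a constituent. (iii) There is a bijection between the sets $Irr_{*}(Z(\chi)/[Z(\chi),G])$ and $nl(G/[Z(\chi),G])$. (iv) There is a bijection between the sets $Irr_{*}(Z(\chi)/[Z(\chi),G])$ and $\{\phi \in nl(G): Z(\phi)=Z(\chi)\}$.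
   Context: All groups are finite and all characters are complex. $Irr(G)$ is the set of irreducible characters of $G$, $nl(G)$ is the set of non-linear irreducible characters of $G$ (those of degree $>1$), and $cd(G)=\{\chi(1):\chi\in Irr(G)\}$. For $\chi\in Irr(G)$, $\ker\chi=\{g\in G:\chi(g)=\chi(1)\}$ and $Z(\chi)=\{g\in G:|\chi(g)|=\chi(1)\}$ (the centre of $\chi$). For subgroups $H,K$ of $G$, $[H,K]$ is the subgroup generated by all $[h,k]=h^{-1}k^{-1}hk$ with $h\in H$, $k\in K$; $G'=[G,G]$. For a subgroup $H\le G$ and a character $\lambda$ of $H$, $\lambda^{G}$ denotes the character of $G$ induced from $\lambda$. A non-abelian group $G$ is a GVZ-group if for every $\chi\in Irr(G)$ one has $\chi(g)=0$ for all $g\in G\setminus Z(\chi)$; equivalently $\chi(1)^2=|G:Z(\chi)|$ for every $\chi\in Irr(G)$. A GVZ-group with two character degrees is a GVZ-group $G$ with $|cd(G)|=2$. *)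

theory Defs
  imports "HOL-Algebra.Algebra" "Jordan_Normal_Form.VS_Connect"
begin

section \<open>Commutators\<close>

text \<open>The commutator convention is \<open>[h, k] = h\<inverse>k\<inverse>hk\<close>, whereas \<^const>\<open>derived\<close> is generated by
  the elements \<open>hkh\<inverse>k\<inverse>\<close>; the lemma below shows that the two give the same subgroup.\<close>

definition commutator_subgroup ::
    "('a, 'b) monoid_scheme \<Rightarrow> 'a set \<Rightarrow> 'a set \<Rightarrow> 'a set" where
  "commutator_subgroup G H K =
     generate G {inv\<^bsub>G\<^esub> h \<otimes>\<^bsub>G\<^esub> inv\<^bsub>G\<^esub> k \<otimes>\<^bsub>G\<^esub> h \<otimes>\<^bsub>G\<^esub> k | h k. h \<in> H \<and> k \<in> K}"

lemma (in group) commutator_subgroup_self_eq_derived: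
  assumes "subgroup H G"
  shows "commutator_subgroup G H H = derived G H"
proof -
  note closed = subgroup.m_inv_closed[OF assms] subgroup.mem_carrier[OF assms]
  have "{inv h \<otimes> inv k \<otimes> h \<otimes> k | h k. h \<in> H \<and> k \<in> H} = derived_set G H" (is "?A = ?B")
  proof
    show "?A \<subseteq> ?B"
    proof
      fix x assume "x \<in> ?A"
      then obtain h k where hk: "h \<in> H" "k \<in> H" "x = inv h \<otimes> inv k \<otimes> h \<otimes> k" by blast
      then have "x = inv h \<otimes> inv k \<otimes> inv (inv h) \<otimes> inv (inv k)"
        using closed by simp
      then show "x \<in> ?B" using hk closed(1) by blast
    qed
    show "?B \<subseteq> ?A"
    proof
      fix x assume "x \<in> ?B"
      then obtain h k where hk: "h \<in> H" "k \<in> H" "x = h \<otimes> k \<otimes> inv h \<otimes> inv k" by blast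
      then have "x = inv (inv h) \<otimes> inv (inv k) \<otimes> inv h \<otimes> inv k"
        using closed by simp
      then show "x \<in> ?A" using hk closed(1) by blast
    qed
  qed
  then show ?thesis
    unfolding commutator_subgroup_def derived_def by simp
qed

section \<open>Irreducible complex characters\<close>

text \<open>A complex representation of degree \<open>n\<close> is a homomorphism into \<open>GL\<^sub>n(\<complex>)\<close>.\<close>

definition representation ::
    "('a, 'b) monoid_scheme \<Rightarrow> nat \<Rightarrow> ('a \<Rightarrow> complex mat) \<Rightarrow> bool" where
  "representation G n \<rho> \<longleftrightarrow> \<rho> \<in> hom G (units_of (ring_mat TYPE(complex) n ()))"

definition irreducible_representation ::
    "('a, 'b) monoid_scheme \<Rightarrow> nat \<Rightarrow> ('a \<Rightarrow> complex mat) \<Rightarrow> bool" where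
  "irreducible_representation G n \<rho> \<longleftrightarrow>
     representation G n \<rho> \<and> n > 0 \<and>
     (\<forall>W. VectorSpace.subspace class_ring W (module_vec TYPE(complex) n) \<and>
          (\<forall>g\<in>carrier G. \<forall>w\<in>W. \<rho> g *\<^sub>v w \<in> W) \<longrightarrow>
          W = {0\<^sub>v n} \<or> W = carrier_vec n)"

definition mat_trace :: "'a::comm_monoid_add mat \<Rightarrow> 'a" where
  "mat_trace A = (\<Sum>i<dim_row A. A $$ (i, i))"

text \<open>Characters are made extensional (\<open>undefined\<close> outside \<^term>\<open>carrier G\<close>), so that equality of
  characters of \<open>G\<close> is equality of HOL functions and sets of characters have the right
  cardinality.\<close>

definition afforded_character ::
    "('a, 'b) monoid_scheme \<Rightarrow> ('a \<Rightarrow> complex mat) \<Rightarrow> 'a \<Rightarrow> complex" where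
  "afforded_character G \<rho> = (\<lambda>g\<in>carrier G. mat_trace (\<rho> g))"

definition Irr :: "('a, 'b) monoid_scheme \<Rightarrow> ('a \<Rightarrow> complex) set" where
  "Irr G = {afforded_character G \<rho> | n \<rho>. irreducible_representation G n \<rho>}"

text \<open>The value \<open>\<chi>(1)\<close> is the degree of a representation, hence a real number; \<^const>\<open>Re\<close> only
  serves to state the inequality \<open>\<chi>(1) > 1\<close>.\<close>

definition nl :: "('a, 'b) monoid_scheme \<Rightarrow> ('a \<Rightarrow> complex) set" where
  "nl G = {\<chi> \<in> Irr G. Re (\<chi> \<one>\<^bsub>G\<^esub>) > 1}"

definition cd :: "('a, 'b) monoid_scheme \<Rightarrow> complex set" where
  "cd G = {\<chi> \<one>\<^bsub>G\<^esub> | \<chi>. \<chi> \<in> Irr G}"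

definition char_ker :: "('a, 'b) monoid_scheme \<Rightarrow> ('a \<Rightarrow> complex) \<Rightarrow> 'a set" where
  "char_ker G \<chi> = {g \<in> carrier G. \<chi> g = \<chi> \<one>\<^bsub>G\<^esub>}"

definition char_centre :: "('a, 'b) monoid_scheme \<Rightarrow> ('a \<Rightarrow> complex) \<Rightarrow> 'a set" where
  "char_centre G \<chi> = {g \<in> carrier G. complex_of_real (cmod (\<chi> g)) = \<chi> \<one>\<^bsub>G\<^esub>}"

section \<open>Induced characters and constituents\<close>

definition induced_character ::
    "('a, 'b) monoid_scheme \<Rightarrow> 'a set \<Rightarrow> ('a \<Rightarrow> complex) \<Rightarrow> 'a \<Rightarrow> complex" where
  "induced_character G H \<mu> = (\<lambda>g\<in>carrier G.
     (\<Sum>x | x \<in> carrier G \<and> x \<otimes>\<^bsub>G\<^esub> g \<otimes>\<^bsub>G\<^esub> inv\<^bsub>G\<^esub> x \<in> H. \<mu> (x \<otimes>\<^bsub>G\<^esub> g \<otimes>\<^bsub>G\<^esub> inv\<^bsub>G\<^esub> x))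
     / of_nat (card H))"

text \<open>\<open>\<phi>\<close> is an irreducible constituent of the character \<open>\<psi>\<close> if it occurs with positive
  multiplicity \<open>m \<phi>\<close> in a decomposition of \<open>\<psi>\<close> into irreducible characters.  The sum is
  meaningful for finite \<open>G\<close>, where \<^term>\<open>Irr G\<close> is finite.\<close>

definition irreducible_constituent ::
    "('a, 'b) monoid_scheme \<Rightarrow> ('a \<Rightarrow> complex) \<Rightarrow> ('a \<Rightarrow> complex) \<Rightarrow> bool" where
  "irreducible_constituent G \<phi> \<psi> \<longleftrightarrow> \<phi> \<in> Irr G \<and>
     (\<exists>m :: ('a \<Rightarrow> complex) \<Rightarrow> nat.
        (\<forall>g\<in>carrier G. \<psi> g = (\<Sum>\<theta>\<in>Irr G. of_nat (m \<theta>) * \<theta> g)) \<and> m \<phi> > 0)"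

section \<open>GVZ-groups\<close>

definition GVZ_group :: "('a, 'b) monoid_scheme \<Rightarrow> bool" where
  "GVZ_group G \<longleftrightarrow> group G \<and> finite (carrier G) \<and> \<not> comm_group G \<and>
     (\<forall>\<chi>\<in>Irr G. \<forall>g\<in>carrier G - char_centre G \<chi>. \<chi> g = 0)"

text \<open>\<open>Irr_star G \<chi>\<close> stands for \<open>Irr\<^sub>*(Z(\<chi>)/[Z(\<chi>),G])\<close>, whose elements are
  characters of \<open>Z(\<chi>)\<close> rather than of the quotient.\<close>

definition Irr_star ::
    "('a, 'b) monoid_scheme \<Rightarrow> ('a \<Rightarrow> complex) \<Rightarrow> ('a \<Rightarrow> complex) set" where
  "Irr_star G \<chi> = (let Z = char_centre G \<chi>; GZ = G\<lparr>carrier := Z\<rparr> in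
     {\<mu> \<in> Irr GZ. commutator_subgroup G Z (carrier G) \<subseteq> char_ker GZ \<mu> \<and>
                  \<not> derived G (carrier G) \<subseteq> char_ker GZ \<mu>})"

end

theory Submission
  imports Defs "Jordan_Normal_Form.Spectral_Radius" "Jordan_Normal_Form.DL_Rank"
begin

text \<open>Write \<open>Z = Z(\<chi>)\<close>, \<open>N = [Z,G]\<close> and \<open>d = \<chi>(1)\<close>.

  A matrix of finite order whose trace has maximal modulus is scalar, so \<open>Z\<close> is the set of elements
  that act as scalars in a representation affording \<open>\<chi>\<close>.  By Schur's lemma a subset \<open>H\<close> of \<open>G\<close> lies
  in the centre of an irreducible character \<open>\<phi>\<close> if and only if \<open>[H,G]\<close> lies in its kernel
  (\<open>subset_char_centre_iff\<close>); with \<open>H = G\<close> this says that the linear characters are those with \<open>G'\<close> in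
  the kernel.  The first orthogonality relation, applied to a character that vanishes off its centre,
  gives \<open>\<phi>(1)\<^sup>2 = |G : Z(\<phi>)|\<close>.  All non-linear characters have degree \<open>d\<close>, hence centres of
  the same order, so for non-linear \<open>\<phi>\<close> the three conditions \<open>Z \<subseteq> Z(\<phi>)\<close>, \<open>Z(\<phi>) = Z\<close> and
  \<open>N \<subseteq> ker \<phi>\<close> are equivalent (\<open>nl_centre_eq_iff\<close>).

  Counting rests on \<open>\<Sum>\<phi>(1)\<^sup>2 = |G : M|\<close>, where \<open>\<phi>\<close> runs over the irreducible characters with the
  normal subgroup \<open>M\<close> in their kernel (\<open>sum_squares_Irr_over\<close>).  Subtracting the linear ones from the
  sum for \<open>M = N\<close> gives \<open>d\<^sup>2 k = |G : N| - |G : G'|\<close> for the number \<open>k\<close> of non-linear \<open>\<phi>\<close> with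
  \<open>Z(\<phi>) = Z\<close>, and \<open>d\<^sup>2 = |G : Z|\<close> turns this into the stated formula.  The same count for \<open>M = Z\<close>
  shows that there are fewer than one, hence no, non-linear characters with \<open>Z\<close> in the kernel, and
  this forces \<open>G' \<subseteq> Z\<close> (\<open>derived_subset_centre\<close>).

  Such a \<open>\<phi>\<close> is determined by the linear character \<open>\<lambda> = \<phi>|\<^sub>Z / d\<close>, because it is \<open>d \<lambda>\<close> on \<open>Z\<close> and \<open>0\<close>
  elsewhere, and \<open>\<lambda>\<close> belongs to \<open>Irr\<^sub>*(Z/N)\<close>.  The latter set has \<open>|Z : N| - |Z : G'|\<close> elements, by
  the sum of squares for the group \<open>Z\<close>, whose characters over \<open>N\<close> are all linear.  This is again \<open>k\<close>, so
  the injection \<open>\<phi> \<mapsto> \<lambda>\<close> is a bijection (\<open>bij_betw_central_character\<close>).  A direct computation yields \<open>\<lambda>\<^sup>G = d \<phi>\<close>, so that \<open>\<phi>\<close> is the only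
  irreducible constituent.  Inflation identifies \<open>nl(G/N)\<close> with the same set of characters \<open>\<phi>\<close>.\<close>

section \<open>Complex matrices of finite order\<close>

lemma mat_trace_mult_comm:
  fixes A B :: "'a::comm_semiring_0 mat"
  assumes "A \<in> carrier_mat n m" "B \<in> carrier_mat m n"
  shows "mat_trace (A * B) = mat_trace (B * A)"
proof -
  have "mat_trace (A * B) = (\<Sum>i<n. \<Sum>k<m. A $$ (i,k) * B $$ (k,i))"
    using assms by (auto simp: mat_trace_def scalar_prod_def atLeast0LessThan intro!: sum.cong)
  also have "\<dots> = (\<Sum>k<m. \<Sum>i<n. B $$ (k,i) * A $$ (i,k))"
    by (subst sum.swap) (simp add: mult.commute)
  also have "\<dots> = mat_trace (B * A)"
    using assms by (auto simp: mat_trace_def scalar_prod_def atLeast0LessThan intro!: sum.cong)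
  finally show ?thesis .
qed

lemma mat_trace_similar:
  fixes A :: "'a::comm_ring_1 mat"
  assumes "A \<in> carrier_mat n n" "P \<in> carrier_mat m n" "Q \<in> carrier_mat n m" "Q * P = 1\<^sub>m n"
  shows "mat_trace (P * A * Q) = mat_trace A"
proof -
  have "mat_trace (P * A * Q) = mat_trace (Q * (P * A))"
    using assms by (intro mat_trace_mult_comm[of _ m n]) auto
  also have "Q * (P * A) = (Q * P) * A"
    using assms by (intro assoc_mult_mat[symmetric]) auto
  finally show ?thesis using assms by simp
qed

lemma upper_triangular_pow:
  fixes B :: "'a::comm_ring_1 mat"
  assumes B: "B \<in> carrier_mat n n" and ut: "upper_triangular B"
  shows "upper_triangular (B ^\<^sub>m k) \<and> (\<forall>i<n. (B ^\<^sub>m k) $$ (i,i) = (B $$ (i,i)) ^ k)"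
proof (induction k)
  case 0
  then show ?case using B by auto
next
  case (Suc k)
  define C where "C = B ^\<^sub>m k"
  have C: "C \<in> carrier_mat n n" and Cu: "\<And>i j. j < i \<Longrightarrow> i < n \<Longrightarrow> C $$ (i,j) = 0"
    and Cd: "\<And>i. i < n \<Longrightarrow> C $$ (i,i) = (B $$ (i,i)) ^ k"
    using Suc B by (auto simp: C_def upper_triangular_def)
  have Bu: "\<And>i j. j < i \<Longrightarrow> i < n \<Longrightarrow> B $$ (i,j) = 0"
    using ut B by (auto simp: upper_triangular_def)
  have entry: "(C * B) $$ (i,j) = (\<Sum>l<n. C $$ (i,l) * B $$ (l,j))" if "i < n" "j < n" for i j
    using that B C by (auto simp: scalar_prod_def atLeast0LessThan)
  have low: "(C * B) $$ (i,j) = 0" if "j < i" "i < n" for i j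
    unfolding entry[OF \<open>i < n\<close> less_trans[OF that]]
  proof (rule sum.neutral, intro ballI)
    fix l assume "l \<in> {..<n}"
    then show "C $$ (i,l) * B $$ (l,j) = 0"
      using Cu[of l i] Bu[of j l] that by (cases "l < i") auto
  qed
  have diag: "(C * B) $$ (i,i) = (B $$ (i,i)) ^ Suc k" if i: "i < n" for i
  proof -
    have "(\<Sum>l<n. C $$ (i,l) * B $$ (l,i)) = (\<Sum>l<n. if l = i then C $$ (i,i) * B $$ (i,i) else 0)"
    proof (rule sum.cong)
      fix l assume "l \<in> {..<n}"
      then show "C $$ (i,l) * B $$ (l,i) = (if l = i then C $$ (i,i) * B $$ (i,i) else 0)"
        using Cu[of l i] Bu[of i l] i by (cases "l < i"; cases "l = i") auto
    qed simp
    also have "\<dots> = C $$ (i,i) * B $$ (i,i)" using i by simp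
    finally show ?thesis using entry[OF i i] Cd[OF i] by (simp add: mult.commute)
  qed
  show ?case
    using low diag B C unfolding pow_mat.simps C_def[symmetric]
    by (auto simp: upper_triangular_def)
qed

text \<open>In characteristic zero a non-zero nilpotent part prevents finite order: if \<open>(i,q)\<close> is the first
  non-zero entry of row \<open>i\<close> to the right of the diagonal, then the \<open>(i,q)\<close> entry of \<open>B\<^sup>k\<close> is
  \<open>k c\<^bsup>k-1\<^esup> B\<^sub>i\<^sub>q\<close>, which is non-zero for \<open>k = m\<close> because \<open>c\<^sup>m = 1\<close>.\<close>
lemma upper_triangular_finite_order_scalar:
  fixes B :: "'a::field_char_0 mat"
  assumes B: "B \<in> carrier_mat n n" and ut: "upper_triangular B"
    and diag: "\<And>i. i < n \<Longrightarrow> B $$ (i,i) = c"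
    and m: "m > 0" "B ^\<^sub>m m = 1\<^sub>m n"
  shows "B = c \<cdot>\<^sub>m 1\<^sub>m n"
proof (rule ccontr)
  assume "B \<noteq> c \<cdot>\<^sub>m 1\<^sub>m n"
  then obtain i j where ij: "i < n" "j < n" and "B $$ (i,j) \<noteq> (c \<cdot>\<^sub>m 1\<^sub>m n) $$ (i,j)"
    using B by (metis carrier_matD eq_matI index_one_mat(2,3) index_smult_mat(2,3))
  then have "i \<noteq> j" "B $$ (i,j) \<noteq> 0" using diag by (auto split: if_splits)
  then have ex: "i < j \<and> j < n \<and> B $$ (i,j) \<noteq> 0"
    using ij ut B by (metis carrier_matD(1) linorder_neqE_nat upper_triangularD)
  define q where "q = (LEAST q. i < q \<and> q < n \<and> B $$ (i,q) \<noteq> 0)"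
  have q: "i < q" "q < n" "B $$ (i,q) \<noteq> 0"
    using LeastI[of "\<lambda>q. i < q \<and> q < n \<and> B $$ (i,q) \<noteq> 0", OF ex] by (auto simp: q_def)
  have least: "B $$ (i,l) = 0" if "i < l" "l < q" for l
    using not_less_Least[of l "\<lambda>q. i < q \<and> q < n \<and> B $$ (i,q) \<noteq> 0"] that q by (auto simp: q_def)
  have Bu: "\<And>i j. j < i \<Longrightarrow> i < n \<Longrightarrow> B $$ (i,j) = 0"
    using ut B by (auto simp: upper_triangular_def)
  have row: "(\<forall>l. i < l \<longrightarrow> l < q \<longrightarrow> (B ^\<^sub>m k) $$ (i,l) = 0) \<and>
             (B ^\<^sub>m k) $$ (i,q) = of_nat k * c ^ (k - 1) * B $$ (i,q)" for k
  proof (induction k)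
    case 0
    then show ?case using B q by auto
  next
    case (Suc k)
    define C where "C = B ^\<^sub>m k"
    have C: "C \<in> carrier_mat n n" using B by (simp add: C_def)
    have Cu: "C $$ (i,l) = 0" if "l < i" for l
      using upper_triangular_pow[OF B ut, of k] B that ij by (auto simp: C_def upper_triangular_def)
    have Cd: "C $$ (i,i) = c ^ k" 
      using upper_triangular_pow[OF B ut, of k] ij diag by (auto simp: C_def)
    have entry: "(C * B) $$ (i,j) = (\<Sum>l<n. C $$ (i,l) * B $$ (l,j))" if "j < n" for j
      using that ij B C by (auto simp: scalar_prod_def atLeast0LessThan)
    have "(C * B) $$ (i,l) = 0" if "i < l" "l < q" for l
      unfolding entry[OF less_trans[OF that(2) q(2)]]
    proof (rule sum.neutral, intro ballI)
      fix p assume p: "p \<in> {..<n}"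
      consider "p < i" | "p = i" | "i < p" "p < q" | "p \<ge> q" by linarith
      then show "C $$ (i,p) * B $$ (p,l) = 0"
      proof cases
        case 3
        then show ?thesis using Suc by (simp add: C_def)
      qed (use Cu least that Bu[of l p] p in auto)
    qed
    moreover have "(C * B) $$ (i,q) = of_nat (Suc k) * c ^ k * B $$ (i,q)"
    proof -
      have "(\<Sum>l<n. C $$ (i,l) * B $$ (l,q)) = (\<Sum>l\<in>{i,q}. C $$ (i,l) * B $$ (l,q))"
      proof (rule sum.mono_neutral_right)
        show "\<forall>l\<in>{..<n} - {i,q}. C $$ (i,l) * B $$ (l,q) = 0"
        proof
          fix p assume p: "p \<in> {..<n} - {i,q}"
          then consider "p < i" | "i < p" "p < q" | "p > q" by fastforce
          then show "C $$ (i,p) * B $$ (p,q) = 0"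
          proof cases
            case 2
            then show ?thesis using Suc by (simp add: C_def)
          qed (use Cu Bu[of q p] p in auto)
        qed
      qed (use ij q in auto)
      also have "\<dots> = c ^ k * B $$ (i,q) + of_nat k * c ^ (k - 1) * B $$ (i,q) * c"
        using q Cd Suc diag[OF q(2)] by (simp add: C_def)
      also have "\<dots> = of_nat (Suc k) * c ^ k * B $$ (i,q)"
        by (cases k) (auto simp: algebra_simps)
      finally show ?thesis using entry[OF q(2)] by simp
    qed
    ultimately show ?case unfolding pow_mat.simps C_def[symmetric] by simp
  qed
  have "(B ^\<^sub>m m) $$ (i,i) = c ^ m"
    using upper_triangular_pow[OF B ut, of m] diag ij by auto
  then have "c ^ m = 1" using m ij by simp
  then have "c \<noteq> 0" using m by (metis power_0_left zero_neq_one neq0_conv)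
  then show False using row[of m] m q ij by auto
qed

text \<open>The diagonal \<open>e\<close> of a Schur triangularization of \<open>A\<close> lists the eigenvalues with multiplicity:
  the diagonal of a power of a triangular matrix is the power of the diagonal, and a triangular
  matrix of finite order with constant diagonal is scalar.\<close>
lemma finite_order_matrix_eigenvalues:
  fixes A :: "complex mat"
  assumes A: "A \<in> carrier_mat n n" and m: "m > 0" "A ^\<^sub>m m = 1\<^sub>m n"
  obtains e where "\<And>i. i < n \<Longrightarrow> e i ^ m = 1"
    and "\<And>k. mat_trace (A ^\<^sub>m k) = (\<Sum>i<n. e i ^ k)"
    and "\<And>c. (\<And>i. i < n \<Longrightarrow> e i = c) \<Longrightarrow> A = c \<cdot>\<^sub>m 1\<^sub>m n"
proof -
  obtain es where "char_poly A = (\<Prod>a\<leftarrow>es. [:- a, 1:])"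
    using char_poly_factorized[OF A] by blast
  then obtain B where B: "B \<in> carrier_mat n n" and ut: "upper_triangular B" and "similar_mat A B"
    using schur_decomposition_exists[OF A] by blast
  then obtain P Q where wit: "similar_mat_wit A B P Q" unfolding similar_mat_def by blast
  note PQ = similar_mat_witD2[OF A wit]
  have powA: "A ^\<^sub>m k = P * B ^\<^sub>m k * Q" for k by (rule similar_mat_wit_pow_id[OF wit])
  have powB: "B ^\<^sub>m k = Q * A ^\<^sub>m k * P" for k
    by (rule similar_mat_wit_pow_id[OF similar_mat_wit_sym[OF wit]])
  have Bm: "B ^\<^sub>m m = 1\<^sub>m n" using powB[of m] m PQ by simp
  show thesis
  proof (rule that[of "\<lambda>i. B $$ (i,i)"])
    fix i assume "i < n"
    then show "B $$ (i,i) ^ m = 1" using upper_triangular_pow[OF B ut, of m] Bm by auto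
  next
    fix k
    have "mat_trace (A ^\<^sub>m k) = mat_trace (B ^\<^sub>m k)"
      unfolding powA using PQ by (intro mat_trace_similar[of _ n _ n]) auto
    also have "\<dots> = (\<Sum>i<n. B $$ (i,i) ^ k)"
      using upper_triangular_pow[OF B ut, of k] B by (simp add: mat_trace_def)
    finally show "mat_trace (A ^\<^sub>m k) = (\<Sum>i<n. B $$ (i,i) ^ k)" .
  next
    fix c assume "\<And>i. i < n \<Longrightarrow> B $$ (i,i) = c"
    then have "B = c \<cdot>\<^sub>m 1\<^sub>m n" by (rule upper_triangular_finite_order_scalar[OF B ut _ m(1) Bm])
    then have "A = P * (c \<cdot>\<^sub>m 1\<^sub>m n) * Q" using PQ by simp
    also have "\<dots> = c \<cdot>\<^sub>m (P * Q)" using PQ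
      by (metis mult_smult_assoc_mat mult_smult_distrib one_carrier_mat right_mult_one_mat)
    finally show "A = c \<cdot>\<^sub>m 1\<^sub>m n" using PQ by simp
  qed
qed

text \<open>The equality case of the triangle inequality.  With \<open>u\<close> the mean of the \<open>e\<^sub>i\<close>, which has modulus 1,
  the numbers \<open>Re (cnj u \<cdot> e\<^sub>i)\<close> are at most 1 and have mean 1, so all of them are 1.\<close>
lemma sum_unit_complex_eq_imp_const:
  fixes e :: "nat \<Rightarrow> complex"
  assumes unit: "\<And>i. i < n \<Longrightarrow> cmod (e i) = 1" and sum: "cmod (\<Sum>i<n. e i) = real n" and i: "i < n"
  shows "e i = (\<Sum>i<n. e i) / of_nat n"
proof -
  define u where "u = (\<Sum>i<n. e i) / of_nat n"
  have n: "n > 0" using i by simp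
  have u: "cmod u = 1" using sum n by (simp add: u_def norm_divide)
  have "(\<Sum>i<n. e i) = of_nat n * u" using n by (simp add: u_def)
  then have "(\<Sum>i<n. cnj u * e i) = cnj u * (of_nat n * u)"
    by (simp only: sum_distrib_left[symmetric])
  also have "\<dots> = of_nat n" using u
    by (metis (no_types, lifting) complex_norm_square mult.assoc mult.commute mult.right_neutral of_real_1 power_one)
  finally have "(\<Sum>i<n. Re (cnj u * e i)) = real n"
    by (metis Re_sum complex_Re_of_nat)
  then have s0: "(\<Sum>i<n. 1 - Re (cnj u * e i)) = 0" by (simp only: sum_subtractf) simp
  have m1: "cmod (cnj u * e j) = 1" if "j < n" for j using unit that u by (simp add: norm_mult)
  have "1 - Re (cnj u * e j) \<ge> 0" if "j < n" for j
    using complex_Re_le_cmod[of "cnj u * e j"] m1[OF that] by simp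
  then have "1 - Re (cnj u * e i) = 0"
    using s0 i by (subst (asm) sum_nonneg_eq_0_iff) auto
  then have re: "Re (cnj u * e i) = 1" by simp
  have "(cmod (cnj u * e i))\<^sup>2 = (Re (cnj u * e i))\<^sup>2 + (Im (cnj u * e i))\<^sup>2" by (rule cmod_power2)
  then have "Im (cnj u * e i) = 0" unfolding re m1[OF i] by simp
  then have "cnj u * e i = 1" using re by (simp add: complex_eq_iff)
  then have "u * (cnj u * e i) = u" by simp
  moreover have "u * cnj u = 1" using u complex_norm_square[of u] by simp
  ultimately show ?thesis by (simp add: mult.assoc[symmetric] u_def)
qed

section \<open>Representations and Schur's lemma\<close>

text \<open>Invertibility of the matrices is automatic, since \<open>\<rho>(g\<inverse>)\<close> is inverse to \<open>\<rho>(g)\<close>.\<close>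
lemma representation_iff:
  assumes "group G"
  shows "representation G n \<rho> \<longleftrightarrow>
    (\<forall>g\<in>carrier G. \<rho> g \<in> carrier_mat n n) \<and>
    (\<forall>g\<in>carrier G. \<forall>h\<in>carrier G. \<rho> (g \<otimes>\<^bsub>G\<^esub> h) = \<rho> g * \<rho> h) \<and> \<rho> \<one>\<^bsub>G\<^esub> = 1\<^sub>m n"
    (is "?L \<longleftrightarrow> ?R")
proof
  interpret G: group G by fact
  let ?U = "units_of (ring_mat TYPE(complex) n ())"
  have U: "group ?U"
    by (intro monoid.units_group ring.is_monoid ring_mat)
  show ?R if L: ?L
  proof -
    have hom: "\<rho> \<in> hom G ?U" using L by (simp add: representation_def)
    have "\<rho> \<one>\<^bsub>G\<^esub> = \<one>\<^bsub>?U\<^esub>" using hom_one[OF hom G.is_group U] .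
    then show ?thesis using hom by (auto simp: hom_def units_of_def Units_def ring_mat_def Pi_def)
  qed
  show ?L if R: ?R
    unfolding representation_def
  proof (rule homI)
    fix g assume g: "g \<in> carrier G"
    then have "\<rho> g * \<rho> (inv\<^bsub>G\<^esub> g) = 1\<^sub>m n" "\<rho> (inv\<^bsub>G\<^esub> g) * \<rho> g = 1\<^sub>m n"
      using R by (metis G.inv_closed G.r_inv, metis G.inv_closed G.l_inv)
    then show "\<rho> g \<in> carrier ?U"
      using R g G.inv_closed[OF g] by (auto simp: units_of_def Units_def ring_mat_def)
  qed (use R in \<open>auto simp: units_of_def ring_mat_def\<close>)
qed

lemma subspace_vec_iff:
  "VectorSpace.subspace class_ring W (module_vec TYPE(complex) n) \<longleftrightarrow>
    W \<subseteq> carrier_vec n \<and> 0\<^sub>v n \<in> W \<and> (\<forall>v\<in>W. \<forall>w\<in>W. v + w \<in> W) \<and> (\<forall>c. \<forall>v\<in>W. c \<cdot>\<^sub>v v \<in> W)"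
  unfolding VectorSpace.subspace_def submodule_def
  by (simp add: vec_vs vec_module module_vec_simps) blast

lemma irreducible_representationD:
  assumes "group G" "irreducible_representation G n \<rho>"
  shows "representation G n \<rho>" "n > 0"
    and "\<And>g. g \<in> carrier G \<Longrightarrow> \<rho> g \<in> carrier_mat n n"
    and "\<And>g h. g \<in> carrier G \<Longrightarrow> h \<in> carrier G \<Longrightarrow> \<rho> (g \<otimes>\<^bsub>G\<^esub> h) = \<rho> g * \<rho> h"
    and "\<rho> \<one>\<^bsub>G\<^esub> = 1\<^sub>m n"
  using assms representation_iff[OF assms(1), of n \<rho>] by (auto simp: irreducible_representation_def)

lemma invariant_subspace_trivial:
  assumes "irreducible_representation G n \<rho>"
    and "W \<subseteq> carrier_vec n" "0\<^sub>v n \<in> W" "\<And>v w. v \<in> W \<Longrightarrow> w \<in> W \<Longrightarrow> v + w \<in> W"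
    and "\<And>c v. v \<in> W \<Longrightarrow> c \<cdot>\<^sub>v v \<in> W"
    and "\<And>g w. g \<in> carrier G \<Longrightarrow> w \<in> W \<Longrightarrow> \<rho> g *\<^sub>v w \<in> W"
  shows "W = {0\<^sub>v n} \<or> W = carrier_vec n"
proof -
  have sub: "VectorSpace.subspace class_ring W (module_vec TYPE(complex) n)"
    unfolding subspace_vec_iff using assms(2-5) by simp
  have "VectorSpace.subspace class_ring W (module_vec TYPE(complex) n) \<and>
      (\<forall>g\<in>carrier G. \<forall>w\<in>W. \<rho> g *\<^sub>v w \<in> W) \<longrightarrow> W = {0\<^sub>v n} \<or> W = carrier_vec n"
    using assms(1) unfolding irreducible_representation_def by (elim conjE) (erule spec)
  then show ?thesis using sub assms(6) by simp
qed

lemma mult_mat_vec_zero: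
  "A \<in> carrier_mat m n \<Longrightarrow> (A :: complex mat) *\<^sub>v 0\<^sub>v n = 0\<^sub>v m"
  by auto

lemma mult_mat_unit_vec:
  "A \<in> carrier_mat m n \<Longrightarrow> j < n \<Longrightarrow> (A :: complex mat) *\<^sub>v unit_vec n j = col A j"
  by (rule eq_vecI) auto

lemma scalar_mat_mult_vec:
  "v \<in> carrier_vec n \<Longrightarrow> (c \<cdot>\<^sub>m 1\<^sub>m n) *\<^sub>v v = c \<cdot>\<^sub>v (v :: complex vec)"
proof -
  assume v: "v \<in> carrier_vec n"
  have "row (c \<cdot>\<^sub>m 1\<^sub>m n) i \<bullet> v = c * v $ i" if "i < n" for i
    using that v by (simp add: row_one smult_scalar_prod_distrib[of _ n])
  then show ?thesis using v by (intro eq_vecI) (simp_all add: mult_mat_vec_def)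
qed

lemma mat_eq_0I:
  assumes "A \<in> carrier_mat m n" "\<And>v. v \<in> carrier_vec n \<Longrightarrow> A *\<^sub>v v = 0\<^sub>v m"
  shows "(A :: complex mat) = 0\<^sub>m m n"
proof (rule eq_matI)
  fix i j assume ij: "i < dim_row (0\<^sub>m m n :: complex mat)" "j < dim_col (0\<^sub>m m n :: complex mat)"
  then have "col A j = 0\<^sub>v m" 
    using assms(2)[of "unit_vec n j"] assms(1) mult_mat_unit_vec[OF assms(1)] by auto
  then show "A $$ (i,j) = 0\<^sub>m m n $$ (i,j)" using ij assms(1)
    by (metis carrier_matD(1) carrier_matD(2) index_col index_zero_mat index_zero_vec(1))
qed (use assms in auto)

text \<open>Schur's lemma.  Kernel and image of \<open>T\<close> are invariant subspaces.  The inverse \<open>U\<close> is built from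
  preimages of the unit vectors, which makes it a right inverse; it is a left inverse because \<open>T\<close> is
  injective and \<open>T (U T - 1) = 0\<close>.\<close>
lemma schur_intertwiner:
  fixes T :: "complex mat"
  assumes G: "group G" and \<rho>: "irreducible_representation G n \<rho>"
    and \<sigma>: "irreducible_representation G m \<sigma>"
    and T: "T \<in> carrier_mat m n" and comm: "\<And>g. g \<in> carrier G \<Longrightarrow> \<sigma> g * T = T * \<rho> g"
    and nz: "T \<noteq> 0\<^sub>m m n"
  obtains U where "U \<in> carrier_mat n m" "T * U = 1\<^sub>m m" "U * T = 1\<^sub>m n"
proof -
  note R = irreducible_representationD[OF G \<rho>] and S = irreducible_representationD[OF G \<sigma>]
  have comm_v: "\<sigma> g *\<^sub>v (T *\<^sub>v v) = T *\<^sub>v (\<rho> g *\<^sub>v v)" if "g \<in> carrier G" "v \<in> carrier_vec n" for g v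
    using that comm R(3) S(3) T by (metis assoc_mult_mat_vec)
  define W where "W = {v \<in> carrier_vec n. T *\<^sub>v v = 0\<^sub>v m}"
  have "W = {0\<^sub>v n} \<or> W = carrier_vec n"
  proof (rule invariant_subspace_trivial[OF \<rho>])
    fix g w assume "g \<in> carrier G" "w \<in> W"
    then show "\<rho> g *\<^sub>v w \<in> W" using comm_v[of g w] R(3)[of g] S(3)[of g] mult_mat_vec_zero[of "\<sigma> g" m m]
      by (auto simp: W_def)
  qed (use T in \<open>auto simp: W_def mult_add_distrib_mat_vec mult_mat_vec\<close>)
  moreover have "W \<noteq> carrier_vec n" using mat_eq_0I[OF T] nz by (auto simp: W_def)
  ultimately have ker: "v = 0\<^sub>v n" if "v \<in> carrier_vec n" "T *\<^sub>v v = 0\<^sub>v m" for v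
    using that by (auto simp: W_def)
  define V where "V = (*\<^sub>v) T ` carrier_vec n"
  have "V = {0\<^sub>v m} \<or> V = carrier_vec m"
  proof (rule invariant_subspace_trivial[OF \<sigma>])
    show "V \<subseteq> carrier_vec m" using T by (auto simp: V_def)
    show "0\<^sub>v m \<in> V" using T by (auto simp: V_def intro!: image_eqI[of _ _ "0\<^sub>v n"])
    fix v w assume "v \<in> V" "w \<in> V"
    then obtain a b where "a \<in> carrier_vec n" "b \<in> carrier_vec n" "v = T *\<^sub>v a" "w = T *\<^sub>v b"
      by (auto simp: V_def)
    then show "v + w \<in> V" using T
      by (auto simp: V_def mult_add_distrib_mat_vec intro!: image_eqI[of _ _ "a + b"])
  next
    fix c v assume "v \<in> V"
    then obtain a where "a \<in> carrier_vec n" "v = T *\<^sub>v a" by (auto simp: V_def)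
    then show "c \<cdot>\<^sub>v v \<in> V" using T
      by (auto simp: V_def mult_mat_vec intro!: image_eqI[of _ _ "c \<cdot>\<^sub>v a"])
  next
    fix g v assume g: "g \<in> carrier G" and "v \<in> V"
    then obtain a where a: "a \<in> carrier_vec n" "v = T *\<^sub>v a" by (auto simp: V_def)
    then have "\<sigma> g *\<^sub>v v = T *\<^sub>v (\<rho> g *\<^sub>v a)" using comm_v g by simp
    then show "\<sigma> g *\<^sub>v v \<in> V" using a R(3)[OF g] by (auto simp: V_def)
  qed
  moreover have "V \<noteq> {0\<^sub>v m}" using mat_eq_0I[OF T] nz by (auto simp: V_def)
  ultimately have "\<forall>j<m. \<exists>u. u \<in> carrier_vec n \<and> T *\<^sub>v u = unit_vec m j"
    unfolding V_def by (metis imageE unit_vec_carrier)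
  then obtain u where u: "\<And>j. j < m \<Longrightarrow> u j \<in> carrier_vec n \<and> T *\<^sub>v u j = unit_vec m j" by metis
  define U where "U = mat_of_cols n (map u [0..<m])"
  have U: "U \<in> carrier_mat n m" by (auto simp: U_def)
  have colU: "col U j = u j" if "j < m" for j using that u by (simp add: U_def)
  have TU: "T * U = 1\<^sub>m m"
  proof (rule eq_matI)
    fix i j assume ij: "i < dim_row (1\<^sub>m m :: complex mat)" "j < dim_col (1\<^sub>m m :: complex mat)"
    have "(T * U) $$ (i,j) = (T *\<^sub>v u j) $ i" using ij T U colU by simp
    then show "(T * U) $$ (i,j) = 1\<^sub>m m $$ (i,j)" using ij u[of j] by simp
  qed (use T U in auto)
  have "U * T - 1\<^sub>m n = 0\<^sub>m n n"
  proof (rule mat_eq_0I)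
    fix v :: "complex vec" assume v: "v \<in> carrier_vec n"
    have "T * (U * T - 1\<^sub>m n) = T * (U * T) - T"
      using T U by (subst mult_minus_distrib_mat) auto
    also have "T * (U * T) = T" using T U TU by (metis assoc_mult_mat left_mult_one_mat)
    also have "T - T = 0\<^sub>m m n" using T by auto
    finally have 0: "T * (U * T - 1\<^sub>m n) = 0\<^sub>m m n" .
    have "T *\<^sub>v ((U * T - 1\<^sub>m n) *\<^sub>v v) = (T * (U * T - 1\<^sub>m n)) *\<^sub>v v"
      using T U v by (intro assoc_mult_mat_vec[symmetric, of _ m n _ n]) auto
    also have "\<dots> = 0\<^sub>v m" unfolding 0 using v by auto
    finally show "(U * T - 1\<^sub>m n) *\<^sub>v v = 0\<^sub>v n"
      using T U v by (intro ker) (auto intro!: mult_mat_vec_carrier)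
  qed (use T U in auto)
  then have diff: "(U * T) $$ (i,j) - 1\<^sub>m n $$ (i,j) = 0" if "i < n" "j < n" for i j
    using that T U by (metis carrier_matD index_minus_mat(1) index_one_mat(2,3) index_zero_mat(1))
  have "U * T = 1\<^sub>m n"
    by (rule eq_matI) (use T U diff in auto)
  then show thesis using that U TU by blast
qed

text \<open>Over \<open>\<complex>\<close> the intertwiner \<open>T\<close> has an eigenvalue \<open>c\<close>; then \<open>T - c\<close> is an intertwiner that is not
  invertible, hence zero.\<close>
lemma schur_scalar:
  assumes G: "group G" and \<rho>: "irreducible_representation G n \<rho>"
    and T: "T \<in> carrier_mat n n" and comm: "\<And>g. g \<in> carrier G \<Longrightarrow> \<rho> g * T = T * \<rho> g"
  obtains c where "T = c \<cdot>\<^sub>m 1\<^sub>m n"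
proof -
  note R = irreducible_representationD[OF G \<rho>]
  obtain c v where "eigenvector T v c"
    using spectrum_non_empty[OF T R(2)] by (auto simp: spectrum_def eigenvalue_def)
  then have v: "v \<in> carrier_vec n" "v \<noteq> 0\<^sub>v n" "T *\<^sub>v v = c \<cdot>\<^sub>v v"
    using T by (auto simp: eigenvector_def)
  define D where "D = T - c \<cdot>\<^sub>m 1\<^sub>m n"
  have D: "D \<in> carrier_mat n n" using T by (auto simp: D_def)
  have commD: "\<rho> g * D = D * \<rho> g" if g: "g \<in> carrier G" for g
    using T R(3)[OF g] comm[OF g]
    by (simp add: D_def mult_minus_distrib_mat[of _ n n] minus_mult_distrib_mat[of _ n n] mult_smult_distrib[of _ n n _ n] mult_smult_assoc_mat[of _ n n _ n])
  have "D *\<^sub>v v = 0\<^sub>v n"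
    using v T by (simp add: D_def minus_mult_distrib_mat_vec[of _ n n] scalar_mat_mult_vec)
  have "D = 0\<^sub>m n n"
  proof (rule ccontr)
    assume "D \<noteq> 0\<^sub>m n n"
    then obtain U where U: "U \<in> carrier_mat n n" "U * D = 1\<^sub>m n"
      using schur_intertwiner[OF G \<rho> \<rho> D commD] by blast
    have "v = (U * D) *\<^sub>v v" using U v by simp
    also have "\<dots> = U *\<^sub>v (D *\<^sub>v v)" using U D v by (intro assoc_mult_mat_vec) auto
    also have "\<dots> = 0\<^sub>v n" using \<open>D *\<^sub>v v = 0\<^sub>v n\<close> U by auto
    finally show False using v by simp
  qed
  have "T = c \<cdot>\<^sub>m 1\<^sub>m n"
  proof (rule eq_matI)
    fix i j assume ij: "i < dim_row (c \<cdot>\<^sub>m 1\<^sub>m n)" "j < dim_col (c \<cdot>\<^sub>m 1\<^sub>m n)"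
    then have "D $$ (i,j) = 0" using \<open>D = 0\<^sub>m n n\<close> by simp
    then show "T $$ (i,j) = (c \<cdot>\<^sub>m 1\<^sub>m n) $$ (i,j)" using ij T by (simp add: D_def)
  qed (use T in auto)
  then show thesis by (rule that)
qed

lemma irreducible_representation_degree_1:
  assumes G: "group G" and \<rho>: "representation G 1 \<rho>"
  shows "irreducible_representation G 1 \<rho>"
  unfolding irreducible_representation_def
proof (intro conjI allI impI)
  fix W assume W: "VectorSpace.subspace class_ring W (module_vec TYPE(complex) 1) \<and>
      (\<forall>g\<in>carrier G. \<forall>w\<in>W. \<rho> g *\<^sub>v w \<in> W)"
  then have Wc: "W \<subseteq> carrier_vec 1" "0\<^sub>v 1 \<in> W" "\<And>c v. v \<in> W \<Longrightarrow> c \<cdot>\<^sub>v v \<in> W"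
    unfolding subspace_vec_iff by auto
  show "W = {0\<^sub>v 1} \<or> W = carrier_vec 1"
  proof (rule disjCI)
    assume "W \<noteq> carrier_vec 1"
    have "w = 0\<^sub>v 1" if w: "w \<in> W" for w
    proof (rule ccontr)
      assume "w \<noteq> 0\<^sub>v 1"
      have wc: "w \<in> carrier_vec 1" using w Wc by auto
      have "w $ 0 \<noteq> 0"
      proof
        assume "w $ 0 = 0"
        then have "w = 0\<^sub>v 1" using wc by (intro eq_vecI) auto
        then show False using \<open>w \<noteq> 0\<^sub>v 1\<close> by simp
      qed
      have "v \<in> W" if v: "v \<in> carrier_vec 1" for v
      proof -
        have "v = (v $ 0 / w $ 0) \<cdot>\<^sub>v w" using v wc \<open>w $ 0 \<noteq> 0\<close> by (intro eq_vecI) auto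
        then show ?thesis using Wc(3)[OF w] by metis
      qed
      then show False using Wc(1) \<open>W \<noteq> carrier_vec 1\<close> by blast
    qed
    then show "W = {0\<^sub>v 1}" using Wc(2) by blast
  qed
qed (use \<rho> in auto)

lemma linear_character_in_Irr:
  assumes G: "group G" and mult: "\<And>g h. g \<in> carrier G \<Longrightarrow> h \<in> carrier G \<Longrightarrow> f (g \<otimes>\<^bsub>G\<^esub> h) = f g * f h"
    and one: "f \<one>\<^bsub>G\<^esub> = 1"
  shows "(\<lambda>g\<in>carrier G. f g) \<in> Irr G"
proof -
  define \<rho> where "\<rho> g = mat 1 1 (\<lambda>_. f g)" for g
  have "representation G 1 \<rho>" unfolding representation_iff[OF G]
  proof (intro conjI ballI)
    fix g h assume "g \<in> carrier G" "h \<in> carrier G"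
    then show "\<rho> (g \<otimes>\<^bsub>G\<^esub> h) = \<rho> g * \<rho> h"
      by (intro eq_matI) (auto simp: \<rho>_def mult scalar_prod_def)
  next
    show "\<rho> \<one>\<^bsub>G\<^esub> = 1\<^sub>m 1" by (rule eq_matI) (auto simp: \<rho>_def one)
  qed (simp add: \<rho>_def)
  then have "irreducible_representation G 1 \<rho>" by (rule irreducible_representation_degree_1[OF G])
  moreover have "(\<lambda>g\<in>carrier G. f g) = afforded_character G \<rho>"
    by (auto simp: afforded_character_def mat_trace_def \<rho>_def)
  ultimately show ?thesis unfolding Irr_def by blast
qed

section \<open>Orthogonality of irreducible characters\<close>

lemma (in group) sum_translate:
  assumes h: "h \<in> carrier G"
  shows "(\<Sum>g\<in>carrier G. f (h \<otimes> g)) = (\<Sum>g\<in>carrier G. f g)"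
  by (rule sum.reindex_bij_witness[of _ "\<lambda>g. inv h \<otimes> g" "\<lambda>g. h \<otimes> g"])
    (use h in \<open>auto simp: m_assoc[symmetric]\<close>)

text \<open>The average \<open>\<Sum>\<^sub>g \<sigma>(g) E\<^sub>j\<^sub>k \<rho>(g\<inverse>)\<close> of the matrix unit \<open>E\<^sub>j\<^sub>k\<close>, written out by entries.  It
  intertwines \<open>\<rho>\<close> and \<open>\<sigma>\<close>, and its entries are the sums that occur in the orthogonality relations.\<close>
definition averaged_unit ::
    "('a, 'b) monoid_scheme \<Rightarrow> nat \<Rightarrow> nat \<Rightarrow> ('a \<Rightarrow> complex mat) \<Rightarrow> ('a \<Rightarrow> complex mat) \<Rightarrow> nat \<Rightarrow> nat \<Rightarrow> complex mat"
  where "averaged_unit G m n \<sigma> \<rho> j k =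
    mat m n (\<lambda>(i,l). \<Sum>g\<in>carrier G. \<sigma> g $$ (i,j) * \<rho> (inv\<^bsub>G\<^esub> g) $$ (k,l))"

lemma averaged_unit_intertwines:
  assumes G: "group G" and \<sigma>: "representation G m \<sigma>" and \<rho>: "representation G n \<rho>"
    and jk: "j < m" "k < n" and h: "h \<in> carrier G"
  shows "\<sigma> h * averaged_unit G m n \<sigma> \<rho> j k = averaged_unit G m n \<sigma> \<rho> j k * \<rho> h"
proof (rule eq_matI)
  interpret G: group G by fact
  note S = representation_iff[OF G, of m \<sigma>, THEN iffD1, OF \<sigma>]
  note R = representation_iff[OF G, of n \<rho>, THEN iffD1, OF \<rho>]
  let ?T = "averaged_unit G m n \<sigma> \<rho> j k"
  have dims: "\<And>g. g \<in> carrier G \<Longrightarrow> dim_row (\<sigma> g) = m" "\<And>g. g \<in> carrier G \<Longrightarrow> dim_col (\<sigma> g) = m"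
    "\<And>g. g \<in> carrier G \<Longrightarrow> dim_row (\<rho> g) = n" "\<And>g. g \<in> carrier G \<Longrightarrow> dim_col (\<rho> g) = n"
    using S R by auto
  have T: "?T \<in> carrier_mat m n" by (simp add: averaged_unit_def)
  fix i l assume "i < dim_row (?T * \<rho> h)" "l < dim_col (?T * \<rho> h)"
  then have il: "i < m" "l < n" using dims h T by auto
  have "(\<sigma> h * ?T) $$ (i,l) = (\<Sum>p<m. \<sigma> h $$ (i,p) * (\<Sum>g\<in>carrier G. \<sigma> g $$ (p,j) * \<rho> (inv\<^bsub>G\<^esub> g) $$ (k,l)))"
    using il h by (simp add: dims averaged_unit_def scalar_prod_def atLeast0LessThan)
  also have "\<dots> = (\<Sum>g\<in>carrier G. (\<Sum>p<m. \<sigma> h $$ (i,p) * \<sigma> g $$ (p,j)) * \<rho> (inv\<^bsub>G\<^esub> g) $$ (k,l))"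
    by (simp add: sum_distrib_left sum_distrib_right mult.assoc) (rule sum.swap)
  also have "\<dots> = (\<Sum>g\<in>carrier G. \<sigma> (h \<otimes>\<^bsub>G\<^esub> g) $$ (i,j) * \<rho> (inv\<^bsub>G\<^esub> g) $$ (k,l))"
    using S h il jk by (intro sum.cong) (auto simp: dims scalar_prod_def atLeast0LessThan)
  also have "\<dots> = (\<Sum>g\<in>carrier G. \<sigma> (h \<otimes>\<^bsub>G\<^esub> g) $$ (i,j) * \<rho> (inv\<^bsub>G\<^esub> (h \<otimes>\<^bsub>G\<^esub> g) \<otimes>\<^bsub>G\<^esub> h) $$ (k,l))"
    using h by (intro sum.cong) (auto simp: G.inv_mult_group G.m_assoc)
  also have "\<dots> = (\<Sum>g\<in>carrier G. \<sigma> g $$ (i,j) * \<rho> (inv\<^bsub>G\<^esub> g \<otimes>\<^bsub>G\<^esub> h) $$ (k,l))"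
    by (rule G.sum_translate[OF h])
  also have "\<dots> = (\<Sum>g\<in>carrier G. \<sigma> g $$ (i,j) * (\<Sum>q<n. \<rho> (inv\<^bsub>G\<^esub> g) $$ (k,q) * \<rho> h $$ (q,l)))"
    using R h il jk by (intro sum.cong) (auto simp: dims scalar_prod_def atLeast0LessThan)
  also have "\<dots> = (\<Sum>q<n. (\<Sum>g\<in>carrier G. \<sigma> g $$ (i,j) * \<rho> (inv\<^bsub>G\<^esub> g) $$ (k,q)) * \<rho> h $$ (q,l))"
    by (simp add: sum_distrib_left sum_distrib_right mult.assoc) (rule sum.swap)
  also have "\<dots> = (?T * \<rho> h) $$ (i,l)"
    using il h by (simp add: dims averaged_unit_def scalar_prod_def atLeast0LessThan)
  finally show "(\<sigma> h * ?T) $$ (i,l) = (?T * \<rho> h) $$ (i,l)" .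
qed (use assms representation_iff[OF G] in \<open>auto simp: averaged_unit_def\<close>)

lemma sum_trace_trace_inv:
  assumes G: "group G" and \<sigma>: "representation G m \<sigma>" and \<rho>: "representation G n \<rho>"
  shows "(\<Sum>g\<in>carrier G. mat_trace (\<sigma> g) * mat_trace (\<rho> (inv\<^bsub>G\<^esub> g))) =
    (\<Sum>i<m. \<Sum>k<n. averaged_unit G m n \<sigma> \<rho> i k $$ (i,k))"
proof -
  interpret G: group G by fact
  note S = representation_iff[OF G, of m \<sigma>, THEN iffD1, OF \<sigma>]
  note R = representation_iff[OF G, of n \<rho>, THEN iffD1, OF \<rho>]
  have "(\<Sum>g\<in>carrier G. mat_trace (\<sigma> g) * mat_trace (\<rho> (inv\<^bsub>G\<^esub> g))) =
    (\<Sum>g\<in>carrier G. \<Sum>i<m. \<Sum>k<n. \<sigma> g $$ (i,i) * \<rho> (inv\<^bsub>G\<^esub> g) $$ (k,k))"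
  proof (rule sum.cong)
    fix g assume g: "g \<in> carrier G"
    have "dim_row (\<sigma> g) = m" "dim_row (\<rho> (inv\<^bsub>G\<^esub> g)) = n" using S R g by auto
    then show "mat_trace (\<sigma> g) * mat_trace (\<rho> (inv\<^bsub>G\<^esub> g)) =
        (\<Sum>i<m. \<Sum>k<n. \<sigma> g $$ (i,i) * \<rho> (inv\<^bsub>G\<^esub> g) $$ (k,k))"
      by (simp add: mat_trace_def sum_product)
  qed simp
  also have "\<dots> = (\<Sum>i<m. \<Sum>g\<in>carrier G. \<Sum>k<n. \<sigma> g $$ (i,i) * \<rho> (inv\<^bsub>G\<^esub> g) $$ (k,k))"
    by (rule sum.swap)
  also have "\<dots> = (\<Sum>i<m. \<Sum>k<n. averaged_unit G m n \<sigma> \<rho> i k $$ (i,k))"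
    by (subst sum.swap) (simp add: averaged_unit_def)
  finally show ?thesis .
qed

lemma afforded_character_eq_if_intertwined:
  assumes G: "group G" and "irreducible_representation G n \<rho>" "irreducible_representation G m \<sigma>"
    and T: "T \<in> carrier_mat m n" "\<And>g. g \<in> carrier G \<Longrightarrow> \<sigma> g * T = T * \<rho> g" "T \<noteq> 0\<^sub>m m n"
  shows "afforded_character G \<sigma> = afforded_character G \<rho>"
proof -
  obtain U where U: "U \<in> carrier_mat n m" "T * U = 1\<^sub>m m" "U * T = 1\<^sub>m n"
    using schur_intertwiner[OF assms] by blast
  have "mat_trace (\<sigma> g) = mat_trace (\<rho> g)" if g: "g \<in> carrier G" for g
  proof -
    have R: "\<rho> g \<in> carrier_mat n n" and S: "\<sigma> g \<in> carrier_mat m m"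
      using irreducible_representationD(3)[OF G] assms(2,3) g by auto
    have "\<sigma> g = \<sigma> g * (T * U)" using U S by simp
    also have "\<dots> = (\<sigma> g * T) * U" using S T U by (intro assoc_mult_mat[symmetric]) auto
    also have "\<dots> = T * \<rho> g * U" using T g by simp
    finally show ?thesis using mat_trace_similar[OF R T(1) U(1) U(3)] by simp
  qed
  then show ?thesis by (auto simp: afforded_character_def)
qed

text \<open>Distinct characters admit no non-zero intertwiner, so every averaged matrix unit vanishes.\<close>
lemma Irr_orthogonal:
  assumes G: "group G" and "\<chi> \<in> Irr G" "\<psi> \<in> Irr G" "\<chi> \<noteq> \<psi>"
  shows "(\<Sum>g\<in>carrier G. \<chi> g * \<psi> (inv\<^bsub>G\<^esub> g)) = 0"
proof -
  interpret G: group G by fact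
  obtain m \<sigma> n \<rho> where \<sigma>: "irreducible_representation G m \<sigma>" "\<chi> = afforded_character G \<sigma>"
    and \<rho>: "irreducible_representation G n \<rho>" "\<psi> = afforded_character G \<rho>"
    using assms by (auto simp: Irr_def)
  note S = irreducible_representationD[OF G \<sigma>(1)] and R = irreducible_representationD[OF G \<rho>(1)]
  have "averaged_unit G m n \<sigma> \<rho> i k $$ (i,k) = 0" if ik: "i < m" "k < n" for i k
  proof -
    have "averaged_unit G m n \<sigma> \<rho> i k = 0\<^sub>m m n"
      using afforded_character_eq_if_intertwined[OF G \<rho>(1) \<sigma>(1) _ averaged_unit_intertwines[OF G S(1) R(1) ik]]
        assms(4) \<sigma> \<rho> by (auto simp: averaged_unit_def)
    then show ?thesis using ik by simp
  qed
  then have "(\<Sum>g\<in>carrier G. mat_trace (\<sigma> g) * mat_trace (\<rho> (inv\<^bsub>G\<^esub> g))) = 0"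
    by (subst sum_trace_trace_inv[OF G S(1) R(1)]) simp
  then show ?thesis by (simp add: \<sigma> \<rho> afforded_character_def)
qed

text \<open>The same representation is taken on both sides; the averaged unit \<open>E\<^sub>i\<^sub>k\<close> is then a scalar matrix,
  and its trace is \<open>|G| \<delta>\<^sub>i\<^sub>k\<close>.\<close>
lemma Irr_norm:
  assumes G: "group G" and fin: "finite (carrier G)" and "\<chi> \<in> Irr G"
  shows "(\<Sum>g\<in>carrier G. \<chi> g * \<chi> (inv\<^bsub>G\<^esub> g)) = of_nat (card (carrier G))"
proof -
  interpret G: group G by fact
  obtain n \<rho> where \<rho>: "irreducible_representation G n \<rho>" "\<chi> = afforded_character G \<rho>"
    using assms by (auto simp: Irr_def)
  note R = irreducible_representationD[OF G \<rho>(1)]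
  let ?T = "averaged_unit G n n \<rho> \<rho>"
  have entry: "?T i k $$ (i,k) = (if i = k then of_nat (card (carrier G)) / of_nat n else 0)"
    if ik: "i < n" "k < n" for i k
  proof -
    have T: "?T i k \<in> carrier_mat n n" by (simp add: averaged_unit_def)
    obtain c where c: "?T i k = c \<cdot>\<^sub>m 1\<^sub>m n"
      using schur_scalar[OF G \<rho>(1) T averaged_unit_intertwines[OF G R(1) R(1) ik]] by blast
    have "of_nat n * c = mat_trace (?T i k)" by (simp add: c mat_trace_def)
    also have "\<dots> = (\<Sum>l<n. \<Sum>g\<in>carrier G. \<rho> g $$ (l,i) * \<rho> (inv\<^bsub>G\<^esub> g) $$ (k,l))"
      by (simp add: mat_trace_def averaged_unit_def)
    also have "\<dots> = (\<Sum>g\<in>carrier G. \<Sum>l<n. \<rho> (inv\<^bsub>G\<^esub> g) $$ (k,l) * \<rho> g $$ (l,i))"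
      by (subst sum.swap) (simp add: mult.commute)
    also have "\<dots> = (\<Sum>g\<in>carrier G. (\<rho> (inv\<^bsub>G\<^esub> g) * \<rho> g) $$ (k,i))"
    proof (rule sum.cong)
      fix g assume g: "g \<in> carrier G"
      show "(\<Sum>l<n. \<rho> (inv\<^bsub>G\<^esub> g) $$ (k,l) * \<rho> g $$ (l,i)) = (\<rho> (inv\<^bsub>G\<^esub> g) * \<rho> g) $$ (k,i)"
        using carrier_matD[OF R(3)[OF g]] carrier_matD[OF R(3)[OF G.inv_closed[OF g]]] ik
        by (simp add: scalar_prod_def atLeast0LessThan)
    qed simp
    also have "\<dots> = (\<Sum>g\<in>carrier G. (1\<^sub>m n) $$ (k,i))"
      using R(5) by (intro sum.cong) (auto simp flip: R(4))
    also have "\<dots> = (if i = k then of_nat (card (carrier G)) else 0)"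
      using ik by simp
    finally have "of_nat n * c = (if i = k then of_nat (card (carrier G)) else 0)" .
    then have "c = (if i = k then of_nat (card (carrier G)) / of_nat n else 0)"
      using R(2) by (auto simp: field_simps)
    then show ?thesis using c ik by simp
  qed
  have "(\<Sum>g\<in>carrier G. mat_trace (\<rho> g) * mat_trace (\<rho> (inv\<^bsub>G\<^esub> g))) =
      (\<Sum>i<n. \<Sum>k<n. if i = k then of_nat (card (carrier G)) / of_nat n else 0)"
    by (subst sum_trace_trace_inv[OF G R(1) R(1)]) (simp add: entry)
  also have "\<dots> = of_nat (card (carrier G))" using R(2) by simp
  finally show ?thesis by (simp add: \<rho> afforded_character_def)
qed

section \<open>Kernel and centre of a character\<close>

locale finite_group = group G for G (structure) +
  assumes finite_carrier: "finite (carrier G)"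
begin

lemma card_carrier_pos: "card (carrier G) > 0"
  using finite_carrier by (simp add: card_gt_0_iff carrier_not_empty)

lemma representation_pow:
  assumes "representation G n \<rho>" and g: "g \<in> carrier G"
  shows "\<rho> (g [^] (k::nat)) = \<rho> g ^\<^sub>m k"
proof -
  note R = assms(1)[unfolded representation_iff[OF is_group]]
  show ?thesis
    by (induction k) (use R g in auto)
qed

text \<open>Since \<open>\<rho>(g)\<close> has finite order its eigenvalues are roots of unity, and the eigenvalues of
  \<open>\<rho>(g\<inverse>) = \<rho>(g)\<^bsup>|G|-1\<^esup>\<close> are their complex conjugates.\<close>
lemma representation_eigenvalues:
  assumes \<rho>: "representation G n \<rho>" and g: "g \<in> carrier G"
  obtains e where "\<And>i. i < n \<Longrightarrow> cmod (e i) = 1"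
    and "mat_trace (\<rho> g) = (\<Sum>i<n. e i)" and "mat_trace (\<rho> (inv g)) = (\<Sum>i<n. cnj (e i))"
    and "\<And>c. (\<And>i. i < n \<Longrightarrow> e i = c) \<Longrightarrow> \<rho> g = c \<cdot>\<^sub>m 1\<^sub>m n"
proof -
  note R = \<rho>[unfolded representation_iff[OF is_group]]
  define m where "m = card (carrier G)"
  have m: "m > 0" using card_carrier_pos by (simp add: m_def)
  have gm: "g [^] m = \<one>" using pow_order_eq_1[OF g] by (simp add: m_def Coset.order_def)
  have A: "\<rho> g \<in> carrier_mat n n" using R g by blast
  have Am: "\<rho> g ^\<^sub>m m = 1\<^sub>m n" using representation_pow[OF \<rho> g, of m] gm R by simp
  obtain e where e: "\<And>i. i < n \<Longrightarrow> e i ^ m = 1"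
    and tr: "\<And>k. mat_trace (\<rho> g ^\<^sub>m k) = (\<Sum>i<n. e i ^ k)"
    and sc: "\<And>c. (\<And>i. i < n \<Longrightarrow> e i = c) \<Longrightarrow> \<rho> g = c \<cdot>\<^sub>m 1\<^sub>m n"
    using finite_order_matrix_eigenvalues[OF A m Am] by blast
  have norm: "cmod (e i) = 1" if "i < n" for i
  proof -
    have "cmod (e i) ^ m = 1" using e[OF that] by (metis norm_one norm_power)
    then show ?thesis using m power_eq_imp_eq_base[of "cmod (e i)" m 1] by simp
  qed
  have inv: "inv g = g [^] (m - 1)"
  proof (rule inv_equality)
    show "g [^] (m - 1) \<otimes> g = \<one>" using gm m g by (metis Suc_diff_1 nat_pow_Suc)
  qed (use g in auto)
  have cnj: "e i ^ (m - 1) = cnj (e i)" if "i < n" for i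
  proof -
    have "e i ^ (m - 1) * e i = 1" using e[OF that] m by (metis Suc_diff_1 power_Suc2)
    moreover have "cnj (e i) * e i = 1"
      using norm[OF that] complex_norm_square[of "e i"] by (simp add: mult.commute)
    moreover have "e i \<noteq> 0" using norm[OF that] by auto
    ultimately show ?thesis by (metis mult_cancel_right)
  qed
  show thesis
  proof (rule that[OF norm])
    show "mat_trace (\<rho> g) = (\<Sum>i<n. e i)" using tr[of 1] A by simp
    show "mat_trace (\<rho> (inv g)) = (\<Sum>i<n. cnj (e i))"
      unfolding inv representation_pow[OF \<rho> g] tr by (intro sum.cong refl) (simp only: cnj lessThan_iff)
  qed (use sc in auto)
qed

lemma IrrE:
  assumes "\<chi> \<in> Irr G"
  obtains n \<rho> where "irreducible_representation G n \<rho>" "n > 0" "\<chi> = afforded_character G \<rho>"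
    "\<And>g. g \<in> carrier G \<Longrightarrow> \<chi> g = mat_trace (\<rho> g)" "\<chi> \<one> = of_nat n"
proof -
  obtain n \<rho> where \<rho>: "irreducible_representation G n \<rho>" "\<chi> = afforded_character G \<rho>"
    using assms by (auto simp: Irr_def)
  note R = irreducible_representationD[OF is_group \<rho>(1)]
  show thesis
    by (rule that[OF \<rho>(1) R(2) \<rho>(2)]) (simp_all add: \<rho>(2) afforded_character_def R(5) mat_trace_def)
qed

lemma Irr_inv_eq_cnj:
  assumes "\<chi> \<in> Irr G" "g \<in> carrier G"
  shows "\<chi> (inv g) = cnj (\<chi> g)"
proof -
  obtain n \<rho> where \<rho>: "irreducible_representation G n \<rho>" "\<And>g. g \<in> carrier G \<Longrightarrow> \<chi> g = mat_trace (\<rho> g)"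
    using IrrE[OF assms(1)] by metis
  obtain e where "mat_trace (\<rho> g) = (\<Sum>i<n. e i)" "mat_trace (\<rho> (inv g)) = (\<Sum>i<n. cnj (e i))"
    using representation_eigenvalues[OF irreducible_representationD(1)[OF is_group \<rho>(1)] assms(2)] by metis
  then show ?thesis using assms by (simp add: \<rho>(2) cnj_sum)
qed

lemma Irr_conj_invariant:
  assumes "\<chi> \<in> Irr G" and x: "x \<in> carrier G" and g: "g \<in> carrier G"
  shows "\<chi> (x \<otimes> g \<otimes> inv x) = \<chi> g"
proof -
  obtain n \<rho> where \<rho>: "irreducible_representation G n \<rho>" "\<And>g. g \<in> carrier G \<Longrightarrow> \<chi> g = mat_trace (\<rho> g)"
    using IrrE[OF assms(1)] by metis
  note R = irreducible_representationD[OF is_group \<rho>(1)]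
  have "\<rho> (inv x) * \<rho> x = 1\<^sub>m n" using R(4)[of "inv x" x] R(5) x by simp
  then have "mat_trace (\<rho> x * \<rho> g * \<rho> (inv x)) = mat_trace (\<rho> g)"
    by (rule mat_trace_similar[rotated 3]) (use R(3) x g in auto)
  then show ?thesis using x g by (simp add: \<rho>(2) R(4))
qed

text \<open>If \<open>|\<chi>(g)| = n\<close>, then \<open>n\<close> eigenvalues of modulus 1 have a sum of modulus \<open>n\<close>, so they all coincide
  and \<open>\<rho>(g)\<close> is scalar.  Conversely, \<open>\<rho>(g) = c\<close> gives \<open>n = c \<chi>(g\<inverse>) = n c (cnj c)\<close>.\<close>
lemma Irr_centre_iff_scalar:
  assumes \<rho>: "irreducible_representation G n \<rho>" and g: "g \<in> carrier G"
  shows "g \<in> char_centre G (afforded_character G \<rho>) \<longleftrightarrow> (\<exists>c. \<rho> g = c \<cdot>\<^sub>m 1\<^sub>m n)"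
proof -
  note R = irreducible_representationD[OF is_group \<rho>]
  let ?\<chi> = "afforded_character G \<rho>"
  have \<chi>: "\<And>g. g \<in> carrier G \<Longrightarrow> ?\<chi> g = mat_trace (\<rho> g)" by (simp add: afforded_character_def)
  have Irr: "?\<chi> \<in> Irr G" using \<rho> by (auto simp: Irr_def)
  have one: "?\<chi> \<one> = of_nat n" using R(5) by (simp add: \<chi> mat_trace_def)
  have centre: "g \<in> char_centre G ?\<chi> \<longleftrightarrow> cmod (?\<chi> g) = real n"
    using g of_real_eq_iff[of "cmod (?\<chi> g)" "real n", where ?'a = complex]
    by (simp add: char_centre_def one)
  show ?thesis
  proof
    assume "g \<in> char_centre G ?\<chi>"
    then have c: "cmod (mat_trace (\<rho> g)) = real n" using centre \<chi> g by simp
    obtain e where e: "\<And>i. i < n \<Longrightarrow> cmod (e i) = 1" "mat_trace (\<rho> g) = (\<Sum>i<n. e i)"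
        "\<And>c. (\<And>i. i < n \<Longrightarrow> e i = c) \<Longrightarrow> \<rho> g = c \<cdot>\<^sub>m 1\<^sub>m n"
      using representation_eigenvalues[OF R(1) g] by metis
    have "\<rho> g = ((\<Sum>i<n. e i) / of_nat n) \<cdot>\<^sub>m 1\<^sub>m n"
      by (rule e(3), rule sum_unit_complex_eq_imp_const[OF e(1)]) (use c e(2) in auto)
    then show "\<exists>c. \<rho> g = c \<cdot>\<^sub>m 1\<^sub>m n" by blast
  next
    assume "\<exists>c. \<rho> g = c \<cdot>\<^sub>m 1\<^sub>m n"
    then obtain c where c: "\<rho> g = c \<cdot>\<^sub>m 1\<^sub>m n" by blast
    have gc: "?\<chi> g = of_nat n * c" using \<chi>[OF g] c by (simp add: mat_trace_def)
    have "1\<^sub>m n = \<rho> g * \<rho> (inv g)" using R(4)[of g "inv g"] R(5) g by simp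
    also have "\<dots> = c \<cdot>\<^sub>m \<rho> (inv g)"
      using R(3)[of "inv g"] g by (simp add: c mult_smult_assoc_mat[of _ n n _ n])
    finally have "mat_trace (1\<^sub>m n :: complex mat) = mat_trace (c \<cdot>\<^sub>m \<rho> (inv g))" by simp
    also have "\<dots> = c * ?\<chi> (inv g)"
      using R(3)[of "inv g"] g by (simp add: \<chi> mat_trace_def sum_distrib_left)
    also have "\<dots> = c * cnj (of_nat n * c)" using Irr_inv_eq_cnj[OF Irr g] gc by simp
    finally have "of_nat n * (c * cnj c) = of_nat n" by (simp add: mat_trace_def algebra_simps)
    then have "c * cnj c = 1" using R(2) by simp
    then have "(cmod c)\<^sup>2 = 1" by (metis complex_norm_square of_real_eq_1_iff of_real_power)
    then have "cmod c = 1" using power_eq_imp_eq_base[of "cmod c" 2 1] by simp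
    then show "g \<in> char_centre G ?\<chi>" unfolding centre gc by (simp add: norm_mult)
  qed
qed

lemma Irr_ker_iff_one:
  assumes \<rho>: "irreducible_representation G n \<rho>" and g: "g \<in> carrier G"
  shows "g \<in> char_ker G (afforded_character G \<rho>) \<longleftrightarrow> \<rho> g = 1\<^sub>m n"
proof
  note R = irreducible_representationD[OF is_group \<rho>]
  let ?\<chi> = "afforded_character G \<rho>"
  have \<chi>: "\<And>g. g \<in> carrier G \<Longrightarrow> ?\<chi> g = mat_trace (\<rho> g)" by (simp add: afforded_character_def)
  have one: "?\<chi> \<one> = of_nat n" using R(5) by (simp add: \<chi> mat_trace_def)
  show "g \<in> char_ker G ?\<chi>" if "\<rho> g = 1\<^sub>m n"
    using that g R(5) by (simp add: char_ker_def \<chi>)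
  assume "g \<in> char_ker G ?\<chi>"
  then have g1: "?\<chi> g = of_nat n" using one by (simp add: char_ker_def)
  then have "g \<in> char_centre G ?\<chi>" using g one by (simp add: char_centre_def)
  then obtain c where c: "\<rho> g = c \<cdot>\<^sub>m 1\<^sub>m n" using Irr_centre_iff_scalar[OF \<rho> g] by blast
  then have "?\<chi> g = of_nat n * c" using \<chi>[OF g] by (simp add: mat_trace_def)
  then have "c = 1" using g1 R(2) by simp
  then show "\<rho> g = 1\<^sub>m n" using c by auto
qed

lemma subgroup_char_ker:
  assumes "\<chi> \<in> Irr G"
  shows "subgroup (char_ker G \<chi>) G"
proof -
  obtain n \<rho> where \<rho>: "irreducible_representation G n \<rho>" "\<chi> = afforded_character G \<rho>"
    using assms by (auto simp: Irr_def)
  note R = irreducible_representationD[OF is_group \<rho>(1)]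
  have ker: "char_ker G \<chi> = {g \<in> carrier G. \<rho> g = 1\<^sub>m n}"
    using Irr_ker_iff_one[OF \<rho>(1)] \<rho>(2) by (auto simp: char_ker_def)
  show ?thesis unfolding ker
  proof (rule subgroupI)
    fix g assume g: "g \<in> {g \<in> carrier G. \<rho> g = 1\<^sub>m n}"
    then have "\<rho> (inv g) = \<rho> g * \<rho> (inv g)" using R(3)[of "inv g"] by simp
    also have "\<dots> = 1\<^sub>m n" using R(4)[of g "inv g"] R(5) g by simp
    finally show "inv g \<in> {g \<in> carrier G. \<rho> g = 1\<^sub>m n}" using g by simp
  qed (use R in auto)
qed

lemma normal_char_centre:
  assumes "\<chi> \<in> Irr G"
  shows "char_centre G \<chi> \<lhd> G"
proof -
  obtain n \<rho> where \<rho>: "irreducible_representation G n \<rho>" "\<chi> = afforded_character G \<rho>"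
    using assms by (auto simp: Irr_def)
  note R = irreducible_representationD[OF is_group \<rho>(1)]
  have Z: "char_centre G \<chi> = {g \<in> carrier G. \<exists>c. \<rho> g = c \<cdot>\<^sub>m 1\<^sub>m n}"
    using Irr_centre_iff_scalar[OF \<rho>(1)] \<rho>(2) by (auto simp: char_centre_def)
  have conj: "x \<otimes> z \<otimes> inv x \<in> char_centre G \<chi>" if x: "x \<in> carrier G" and z: "z \<in> char_centre G \<chi>" for x z
    using Irr_conj_invariant[OF assms x, of z] z x by (auto simp: char_centre_def)
  have inv: "inv g \<in> char_centre G \<chi>" if "g \<in> char_centre G \<chi>" for g
    using that Irr_inv_eq_cnj[OF assms, of g] by (auto simp: char_centre_def)
  have mult: "g \<otimes> h \<in> char_centre G \<chi>" if gh: "g \<in> char_centre G \<chi>" "h \<in> char_centre G \<chi>" for g h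
  proof -
    obtain c d where cd: "g \<in> carrier G" "h \<in> carrier G" "\<rho> g = c \<cdot>\<^sub>m 1\<^sub>m n" "\<rho> h = d \<cdot>\<^sub>m 1\<^sub>m n"
      using gh unfolding Z by blast
    have "\<rho> (g \<otimes> h) = (c * d) \<cdot>\<^sub>m 1\<^sub>m n"
      unfolding R(4)[OF cd(1,2)] cd(3,4) mult_smult_assoc_mat[OF one_carrier_mat smult_carrier_mat[OF one_carrier_mat]]
      by (rule eq_matI) auto
    then show ?thesis using cd unfolding Z by auto
  qed
  have one: "\<one> \<in> char_centre G \<chi>"
  proof -
    obtain k where "\<chi> \<one> = of_nat k" using IrrE[OF assms] by metis
    then show ?thesis by (simp add: char_centre_def)
  qed
  have "subgroup (char_centre G \<chi>) G"
    by (rule subgroupI) (use one inv mult in \<open>auto simp: char_centre_def\<close>)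
  then show ?thesis using conj by (simp add: normal_inv_iff)
qed

text \<open>By Schur's lemma \<open>\<rho>(h)\<close> is scalar if and only if it commutes with every \<open>\<rho>(k)\<close>, which says that
  all commutators \<open>[h,k]\<close> act trivially.\<close>
lemma subset_char_centre_iff:
  assumes "\<chi> \<in> Irr G" and H: "H \<subseteq> carrier G"
  shows "H \<subseteq> char_centre G \<chi> \<longleftrightarrow> commutator_subgroup G H (carrier G) \<subseteq> char_ker G \<chi>"
proof -
  obtain n \<rho> where \<rho>: "irreducible_representation G n \<rho>" "\<chi> = afforded_character G \<rho>"
    using assms by (auto simp: Irr_def)
  note R = irreducible_representationD[OF is_group \<rho>(1)]
  note centre = Irr_centre_iff_scalar[OF \<rho>(1), folded \<rho>(2)]
  note ker = Irr_ker_iff_one[OF \<rho>(1), folded \<rho>(2)]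
  have comm: "inv h \<otimes> inv k \<otimes> h \<otimes> k \<in> char_ker G \<chi> \<longleftrightarrow> \<rho> h * \<rho> k = \<rho> k * \<rho> h"
    if hk: "h \<in> carrier G" "k \<in> carrier G" for h k
  proof -
    let ?c = "inv h \<otimes> inv k \<otimes> h \<otimes> k"
    have c: "?c \<in> carrier G" using hk by simp
    have "x \<otimes> (inv x \<otimes> y) = y" if "x \<in> carrier G" "y \<in> carrier G" for x y
      using that by (simp add: m_assoc[symmetric])
    then have "k \<otimes> h \<otimes> ?c = h \<otimes> k" using hk by (simp add: m_assoc)
    then have eq: "\<rho> (k \<otimes> h) * \<rho> ?c = \<rho> (h \<otimes> k)" using R(4)[of "k \<otimes> h" ?c] hk c by simp
    have unit: "\<rho> (inv (k \<otimes> h)) * \<rho> (k \<otimes> h) = 1\<^sub>m n"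
      using R(4)[of "inv (k \<otimes> h)" "k \<otimes> h"] R(5) hk by (simp del: inv_mult_group)
    have "\<rho> ?c = 1\<^sub>m n \<longleftrightarrow> \<rho> (h \<otimes> k) = \<rho> (k \<otimes> h)"
    proof
      assume "\<rho> ?c = 1\<^sub>m n"
      then show "\<rho> (h \<otimes> k) = \<rho> (k \<otimes> h)" using eq R(3)[of "k \<otimes> h"] hk by simp
    next
      assume a: "\<rho> (h \<otimes> k) = \<rho> (k \<otimes> h)"
      have "\<rho> ?c = (\<rho> (inv (k \<otimes> h)) * \<rho> (k \<otimes> h)) * \<rho> ?c" unfolding unit using R(3)[OF c] by simp
      also have "\<dots> = \<rho> (inv (k \<otimes> h)) * (\<rho> (k \<otimes> h) * \<rho> ?c)"
        using R(3) hk c by (intro assoc_mult_mat[of _ n n _ n _ n]) auto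
      also have "\<dots> = 1\<^sub>m n" using eq a unit by simp
      finally show "\<rho> ?c = 1\<^sub>m n" .
    qed
    then show ?thesis using ker[OF c] R(4) hk by simp
  qed
  show ?thesis
  proof
    assume HZ: "H \<subseteq> char_centre G \<chi>"
    have "inv h \<otimes> inv k \<otimes> h \<otimes> k \<in> char_ker G \<chi>" if hk: "h \<in> H" "k \<in> carrier G" for h k
    proof -
      obtain c where c: "\<rho> h = c \<cdot>\<^sub>m 1\<^sub>m n" using centre[of h] HZ H hk by blast
      have "\<rho> h * \<rho> k = \<rho> k * \<rho> h" using R(3)[OF hk(2)]
        by (simp add: c mult_smult_assoc_mat[of _ n n _ n] mult_smult_distrib[of _ n n _ n])
      then show ?thesis using comm[of h k] hk H by auto
    qed
    then show "commutator_subgroup G H (carrier G) \<subseteq> char_ker G \<chi>"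
      unfolding commutator_subgroup_def
      by (intro generate_subgroup_incl subgroup_char_ker[OF assms(1)]) auto
  next
    assume N: "commutator_subgroup G H (carrier G) \<subseteq> char_ker G \<chi>"
    show "H \<subseteq> char_centre G \<chi>"
    proof
      fix h assume h: "h \<in> H"
      have "\<rho> k * \<rho> h = \<rho> h * \<rho> k" if k: "k \<in> carrier G" for k
      proof -
        have "inv h \<otimes> inv k \<otimes> h \<otimes> k \<in> commutator_subgroup G H (carrier G)"
          unfolding commutator_subgroup_def by (rule generate.incl) (use h k in blast)
        then have "inv h \<otimes> inv k \<otimes> h \<otimes> k \<in> char_ker G \<chi>" using N by blast
        then show ?thesis using comm[OF subsetD[OF H h] k] by simp
      qed
      then obtain c where "\<rho> h = c \<cdot>\<^sub>m 1\<^sub>m n"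
        using schur_scalar[OF is_group \<rho>(1), of "\<rho> h"] R(3) h H by blast
      then show "h \<in> char_centre G \<chi>" using centre[of h] h H by blast
    qed
  qed
qed

text \<open>The case \<open>H = G\<close> of the preceding lemma: if all of \<open>G\<close> acts by scalars, every subspace is
  invariant, and irreducibility leaves only dimension 1.\<close>
lemma Irr_linear_iff:
  assumes "\<chi> \<in> Irr G"
  shows "\<chi> \<one> = 1 \<longleftrightarrow> derived G (carrier G) \<subseteq> char_ker G \<chi>"
proof -
  obtain n \<rho> where \<rho>: "irreducible_representation G n \<rho>" "\<chi> = afforded_character G \<rho>" "\<chi> \<one> = of_nat n"
    using IrrE[OF assms] by metis
  note R = irreducible_representationD[OF is_group \<rho>(1)]
  note centre = Irr_centre_iff_scalar[OF \<rho>(1), folded \<rho>(2)]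
  have "derived G (carrier G) \<subseteq> char_ker G \<chi> \<longleftrightarrow> carrier G \<subseteq> char_centre G \<chi>"
    using subset_char_centre_iff[OF assms order_refl] commutator_subgroup_self_eq_derived[OF subgroup_self]
    by simp
  also have "\<dots> \<longleftrightarrow> n = 1"
  proof
    assume n: "n = 1"
    have "\<rho> g = (\<rho> g $$ (0,0)) \<cdot>\<^sub>m 1\<^sub>m n" if "g \<in> carrier G" for g
      using R(3)[OF that] n by (intro eq_matI) auto
    then show "carrier G \<subseteq> char_centre G \<chi>" using centre by blast
  next
    assume "carrier G \<subseteq> char_centre G \<chi>"
    then have sc: "\<exists>c. \<rho> g = c \<cdot>\<^sub>m 1\<^sub>m n" if "g \<in> carrier G" for g using centre that by blast
    \<comment> \<open>A hyperplane, which is neither zero nor everything as soon as \<open>n > 1\<close>.\<close>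
    define W where "W = {v \<in> carrier_vec n. v $ 0 = (0::complex)}"
    have "W = {0\<^sub>v n} \<or> W = carrier_vec n"
    proof (rule invariant_subspace_trivial[OF \<rho>(1)])
      fix g w assume "g \<in> carrier G" "w \<in> W"
      moreover obtain c where "\<rho> g = c \<cdot>\<^sub>m 1\<^sub>m n" using sc[OF \<open>g \<in> carrier G\<close>] by blast
      ultimately show "\<rho> g *\<^sub>v w \<in> W" using R(2) by (auto simp: W_def scalar_mat_mult_vec)
    qed (use R(2) in \<open>auto simp: W_def\<close>)
    moreover have "unit_vec n 0 \<in> carrier_vec n - W" using R(2) by (auto simp: W_def)
    ultimately have W: "W = {0\<^sub>v n}" by blast
    show "n = 1"
    proof (rule ccontr)
      assume "n \<noteq> 1"
      then have n: "1 < n" using R(2) by simp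
      then have "unit_vec n 1 \<in> W" by (auto simp: W_def)
      then show False using W n by auto
    qed
  qed
  finally show ?thesis using \<rho>(3) by simp
qed

end

section \<open>The regular character and the sum of the squared degrees\<close>

text \<open>The first \<open>k\<close> columns of \<open>P\<close> are a basis of \<open>W\<close>, extended to a basis of \<open>\<complex>\<^sup>n\<close> by the others.  Since
  \<open>Q = P\<inverse>\<close> computes coordinates, \<open>W\<close> is where the last \<open>n - k\<close> coordinates vanish.\<close>
lemma subspace_adapted_basis:
  assumes W: "VectorSpace.subspace class_ring W (module_vec TYPE(complex) n)"
  obtains P Q k where "P \<in> carrier_mat n n" "Q \<in> carrier_mat n n" "P * Q = 1\<^sub>m n" "Q * P = 1\<^sub>m n" "k \<le> n"
    "W = {v \<in> carrier_vec n. \<forall>i. k \<le> i \<longrightarrow> i < n \<longrightarrow> (Q *\<^sub>v v) $ i = 0}"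
proof -
  interpret vec_space "TYPE(complex)" n .
  have Wc: "W \<subseteq> carrier_vec n" and W0: "0\<^sub>v n \<in> W"
    and Wadd: "\<And>v w. v \<in> W \<Longrightarrow> w \<in> W \<Longrightarrow> v + w \<in> W" and Wsm: "\<And>c v. v \<in> W \<Longrightarrow> c \<cdot>\<^sub>v v \<in> W"
    using W unfolding subspace_vec_iff by auto
  have bound: "finite T \<and> card T \<le> n" if "T \<subseteq> carrier_vec n" "lin_indpt T" for T
    using li_le_dim[OF fin_dim that(1) that(2)] dim_is_n by auto
  have empty: "lin_indpt {}" unfolding lin_dep_def by auto
  obtain A where A: "finite A" "maximal A (\<lambda>T. T \<subseteq> W \<and> lin_indpt T)"
    using maximal_exists[of "\<lambda>T. T \<subseteq> W \<and> lin_indpt T" n "{}"] bound Wc empty by blast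
  have AW: "A \<subseteq> W" "lin_indpt A" using A(2) by (auto simp: maximal_def)
  have AC: "A \<subseteq> carrier_vec n" using AW Wc by auto
  have span: "W \<subseteq> span A"
  proof
    fix w assume w: "w \<in> W"
    show "w \<in> span A"
    proof (cases "w \<in> A")
      case True
      then show ?thesis using in_own_span[OF AC] by blast
    next
      case False
      show ?thesis
      proof (rule ccontr)
        assume "w \<notin> span A"
        then have "lin_indpt (A \<union> {w})"
          using lin_dep_iff_in_span[OF AC AW(2) _ False] w Wc by blast
        then have "A \<union> {w} = A" using A(2) AW(1) w unfolding maximal_def by auto
        then show False using False by auto
      qed
    qed
  qed
  obtain B where B: "finite B" "maximal B (\<lambda>T. A \<subseteq> T \<and> T \<subseteq> carrier_vec n \<and> lin_indpt T)"
    using maximal_exists[of "\<lambda>T. A \<subseteq> T \<and> T \<subseteq> carrier_vec n \<and> lin_indpt T" n A] bound AC AW(2) by blast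
  have B': "A \<subseteq> B" "B \<subseteq> carrier_vec n" "lin_indpt B" using B(2) by (auto simp: maximal_def)
  have "maximal B (\<lambda>T. T \<subseteq> carrier_vec n \<and> lin_indpt T)"
    using B(2) unfolding maximal_def by blast
  then have "basis B" by (intro max_li_is_basis) simp
  then have cardB: "card B = n" using dim_basis[OF B(1)] dim_is_n by simp
  obtain us where us: "set us = A" "distinct us" using finite_distinct_list[OF A(1)] by blast
  obtain vs where vs: "set vs = B - A" "distinct vs"
    using finite_distinct_list[of "B - A"] B(1) by blast
  define ws where "ws = us @ vs"
  define k where "k = length us"
  have ws: "set ws = B" "distinct ws" using us vs B' by (auto simp: ws_def)
  have len: "length ws = n" using ws cardB distinct_card by fastforce
  have k: "k \<le> n" using len by (simp add: k_def ws_def)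
  define P where "P = mat_of_cols n ws"
  have P: "P \<in> carrier_mat n n" using len by (auto simp: P_def)
  have cols: "cols P = ws" using ws B' by (simp add: P_def)
  have "rank P = n" using lin_indpt_full_rank[OF P] cols ws B' by simp
  then have "det P \<noteq> 0" using det_rank_iff[OF P] by simp
  then have "P \<in> Units (ring_mat TYPE(complex) n ())" by (rule det_non_zero_imp_unit[OF P])
  then obtain Q where Q: "Q \<in> carrier_mat n n" "P * Q = 1\<^sub>m n" "Q * P = 1\<^sub>m n"
    unfolding Units_def ring_mat_def by auto
  have QP: "Q *\<^sub>v col P j = unit_vec n j" if "j < n" for j
  proof -
    have "Q *\<^sub>v col P j = col (Q * P) j" using col_mult2[OF Q(1) P that] by simp
    then show ?thesis using Q that by simp
  qed
  have colA: "col P j \<in> A" if "j < k" for j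
  proof -
    have "j < length ws" using that k len by simp
    then have "col P j = ws ! j" using cols_nth[of j P] cols len P by simp
    also have "\<dots> = us ! j" using that by (simp add: ws_def k_def nth_append)
    finally show ?thesis using us that by (auto simp: k_def)
  qed
  have Acol: "\<exists>j<k. a = col P j" if "a \<in> A" for a
  proof -
    have "a \<in> set us" using that us(1) by simp
    then obtain j where "j < length us" "us ! j = a" by (meson in_set_conv_nth)
    then have j: "j < k" "a = us ! j" by (simp_all add: k_def)
    then have "a = ws ! j" by (simp add: ws_def k_def nth_append)
    moreover have "col P j = cols P ! j" using j k P by simp
    ultimately show ?thesis using j cols by auto
  qed
  define U where "U = {v \<in> carrier_vec n. \<forall>i. k \<le> i \<longrightarrow> i < n \<longrightarrow> (Q *\<^sub>v v) $ i = 0}"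
  have row: "row Q i \<in> carrier_vec n" for i using Q by auto
  have "VectorSpace.subspace class_ring U (module_vec TYPE(complex) n)"
    unfolding subspace_vec_iff
    using Q by (auto simp: U_def scalar_prod_add_distrib[OF row] scalar_prod_smult_distrib[OF row])
  moreover have "A \<subseteq> U"
  proof
    fix a assume a: "a \<in> A"
    then obtain j where "j < k" "a = col P j" using Acol by blast
    moreover from this have "\<forall>i. k \<le> i \<longrightarrow> i < n \<longrightarrow> (Q *\<^sub>v col P j) $ i = 0"
      using QP[of j] k by (simp del: index_mult_mat_vec)
    moreover have "col P j \<in> carrier_vec n" by (rule carrier_vecI) (use P in simp)
    ultimately show "a \<in> U" unfolding U_def by blast
  qed
  ultimately have "span A \<subseteq> U" by (intro span_is_subset) (auto simp: VectorSpace.subspace_def)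
  then have "W \<subseteq> U" using span by blast
  moreover have "U \<subseteq> W"
  proof
    fix v assume v: "v \<in> U"
    define c where "c = Q *\<^sub>v v"
    have c: "c \<in> carrier_vec n" and c0: "\<And>i. k \<le> i \<Longrightarrow> i < n \<Longrightarrow> c $ i = 0"
      using v Q by (auto simp: U_def c_def)
    \<comment> \<open>The truncations of \<open>c\<close> to its first \<open>t\<close> coordinates lead to \<open>P c \<in> W\<close> by adding one column of
        \<open>P\<close> at a time.\<close>
    define tr where "tr t = vec n (\<lambda>i. if i < t then c $ i else 0)" for t :: nat
    have tr: "tr t \<in> carrier_vec n" for t by (simp add: tr_def)
    have "P *\<^sub>v tr t \<in> W" if "t \<le> k" for t
      using that
    proof (induction t)
      case 0
      have "tr 0 = 0\<^sub>v n" by (rule eq_vecI) (auto simp: tr_def)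
      then show ?case using W0 P by (simp add: mult_mat_vec_zero)
    next
      case (Suc t)
      have t: "t < n" using Suc k by simp
      have "tr (Suc t) = tr t + c $ t \<cdot>\<^sub>v unit_vec n t"
        by (rule eq_vecI) (use t in \<open>auto simp: tr_def less_Suc_eq\<close>)
      then have "P *\<^sub>v tr (Suc t) = P *\<^sub>v tr t + c $ t \<cdot>\<^sub>v col P t"
        using P tr t by (simp add: mult_add_distrib_mat_vec[of _ n n] mult_mat_vec[of _ n n] mult_mat_unit_vec)
      then show ?case using Suc colA[of t] AW Wadd Wsm by auto
    qed
    moreover have "tr k = c" by (rule eq_vecI) (use c c0 in \<open>auto simp: tr_def\<close>)
    moreover have "P *\<^sub>v c = v"
    proof -
      have "P *\<^sub>v c = (P * Q) *\<^sub>v v"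
        using assoc_mult_mat_vec[OF P Q(1), of v] v by (simp add: c_def U_def)
      then show ?thesis using Q v by (simp add: U_def)
    qed
    ultimately show "v \<in> W" by (metis order_refl)
  qed
  ultimately have "W = U" by blast
  then show thesis using that P Q k by (simp add: U_def)
qed

lemma sum_lessThan_split:
  "k \<le> n \<Longrightarrow> (\<Sum>i<n. f i) = (\<Sum>i<k. f i) + (\<Sum>i<n - k. f (i + k :: nat))" for f :: "nat \<Rightarrow> 'c::comm_monoid_add"
  using sum.nat_diff_reindex[of f n] sum.atLeastLessThan_concat[of 0 k n f] sum.shift_bounds_nat_ivl[of f 0 k "n - k"]
  by (simp add: atLeast0LessThan)

text \<open>An invariant subspace makes the representation block triangular in an adapted basis, and the trace
  is the sum of the traces of the two diagonal blocks, which are representations of smaller degree.\<close>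
lemma trace_eq_sum_Irr:
  assumes G: "group G" and "representation G n \<rho>"
  shows "\<exists>\<psi>s. set \<psi>s \<subseteq> Irr G \<and> (\<forall>g\<in>carrier G. mat_trace (\<rho> g) = (\<Sum>\<psi>\<leftarrow>\<psi>s. \<psi> g))"
  using assms(2)
proof (induction n arbitrary: \<rho> rule: less_induct)
  case (less n)
  interpret G: group G by fact
  note rep = less.prems[unfolded representation_iff[OF G]]
  have Rc: "\<And>g. g \<in> carrier G \<Longrightarrow> \<rho> g \<in> carrier_mat n n" 
    and Rm: "\<And>g h. g \<in> carrier G \<Longrightarrow> h \<in> carrier G \<Longrightarrow> \<rho> (g \<otimes>\<^bsub>G\<^esub> h) = \<rho> g * \<rho> h"
    and R1: "\<rho> \<one>\<^bsub>G\<^esub> = 1\<^sub>m n" using rep by auto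
  consider "n = 0" | "irreducible_representation G n \<rho>" | "n > 0" "\<not> irreducible_representation G n \<rho>" by blast
  then show ?case
  proof cases
    case 1
    then have "mat_trace (\<rho> g) = 0" if "g \<in> carrier G" for g
      using Rc[OF that] by (simp add: mat_trace_def)
    then show ?thesis by (intro exI[of _ "[]"]) simp
  next
    case 2
    then show ?thesis
      by (intro exI[of _ "[afforded_character G \<rho>]"]) (auto simp: Irr_def afforded_character_def)
  next
    case 3
    then obtain W where W: "VectorSpace.subspace class_ring W (module_vec TYPE(complex) n)"
      and inv: "\<And>g w. g \<in> carrier G \<Longrightarrow> w \<in> W \<Longrightarrow> \<rho> g *\<^sub>v w \<in> W"
      and proper: "W \<noteq> {0\<^sub>v n}" "W \<noteq> carrier_vec n"
      using less.prems unfolding irreducible_representation_def by blast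
    obtain P Q k where PQ: "P \<in> carrier_mat n n" "Q \<in> carrier_mat n n" "P * Q = 1\<^sub>m n" "Q * P = 1\<^sub>m n"
      and kn: "k \<le> n" and Weq: "W = {v \<in> carrier_vec n. \<forall>i. k \<le> i \<longrightarrow> i < n \<longrightarrow> (Q *\<^sub>v v) $ i = 0}"
      using subspace_adapted_basis[OF W] by blast
    have "k \<noteq> n" using proper(2) Weq by auto
    then have k1: "k < n" using kn by simp
    have k0: "0 < k"
    proof (rule ccontr)
      assume "\<not> 0 < k"
      have "v = 0\<^sub>v n" if "v \<in> W" for v
      proof -
        have v: "v \<in> carrier_vec n" using that Weq by auto
        have "Q *\<^sub>v v = 0\<^sub>v n" using that \<open>\<not> 0 < k\<close> PQ by (intro eq_vecI) (auto simp: Weq)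
        then have "P *\<^sub>v (Q *\<^sub>v v) = 0\<^sub>v n" using PQ by (simp add: mult_mat_vec_zero)
        moreover have "P *\<^sub>v (Q *\<^sub>v v) = (P * Q) *\<^sub>v v"
          by (rule assoc_mult_mat_vec[OF PQ(1,2) v, symmetric])
        ultimately show ?thesis using PQ v by simp
      qed
      moreover have "0\<^sub>v n \<in> W" using W by (simp add: subspace_vec_iff)
      ultimately show False using proper(1) by blast
    qed
    define M where "M g = Q * \<rho> g * P" for g
    have M: "M g \<in> carrier_mat n n" if "g \<in> carrier G" for g using PQ Rc[OF that] by (simp add: M_def)
    have Mm: "M (g \<otimes>\<^bsub>G\<^esub> h) = M g * M h" if gh: "g \<in> carrier G" "h \<in> carrier G" for g h
    proof -
      have c: "\<rho> g \<in> carrier_mat n n" "\<rho> h \<in> carrier_mat n n" using Rc gh by auto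
      have "P * (Q * \<rho> h * P) = P * Q * (\<rho> h * P)"
        using PQ(1,2) c by (simp add: assoc_mult_mat[of _ n n _ n _ n])
      also have "\<dots> = \<rho> h * P" using c PQ by simp
      finally have cancel: "P * (Q * \<rho> h * P) = \<rho> h * P" .
      have "M g * M h = Q * \<rho> g * (P * (Q * \<rho> h * P))"
        unfolding M_def using PQ(1,2) c by (intro assoc_mult_mat[of _ n n _ n _ n]) auto
      also have "\<dots> = Q * (\<rho> g * \<rho> h) * P"
        unfolding cancel using PQ(1,2) c by (simp add: assoc_mult_mat[of _ n n _ n _ n])
      finally show ?thesis using gh by (simp add: M_def Rm)
    qed
    have M1: "M \<one>\<^bsub>G\<^esub> = 1\<^sub>m n" using PQ by (simp add: M_def R1)
    have Mtr: "mat_trace (M g) = mat_trace (\<rho> g)" if "g \<in> carrier G" for g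
      unfolding M_def using PQ Rc[OF that] by (intro mat_trace_similar[of _ n _ n]) auto
    have M0: "M g $$ (i,j) = 0" if g: "g \<in> carrier G" and ij: "k \<le> i" "i < n" "j < k" for g i j
    proof -
      have jn: "j < n" using ij by simp
      have "Q *\<^sub>v col P j = col (Q * P) j" using col_mult2[OF PQ(2,1) jn] by simp
      then have "Q *\<^sub>v col P j = unit_vec n j" using PQ jn by simp
      then have "\<forall>i. k \<le> i \<longrightarrow> i < n \<longrightarrow> (Q *\<^sub>v col P j) $ i = 0"
        using ij by (simp del: index_mult_mat_vec)
      moreover have cP: "col P j \<in> carrier_vec n" by (rule carrier_vecI) (use PQ in simp)
      ultimately have "col P j \<in> W" unfolding Weq by blast
      then have "(Q *\<^sub>v (\<rho> g *\<^sub>v col P j)) $ i = 0" using inv[OF g] ij by (auto simp: Weq)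
      also have "Q *\<^sub>v (\<rho> g *\<^sub>v col P j) = col (M g) j"
      proof -
        have "col (M g) j = (Q * \<rho> g) *\<^sub>v col P j"
          unfolding M_def using PQ Rc[OF g] jn by (intro col_mult2[of _ n n _ n]) auto
        also have "\<dots> = Q *\<^sub>v (\<rho> g *\<^sub>v col P j)" by (rule assoc_mult_mat_vec[OF PQ(2) Rc[OF g] cP])
        finally show ?thesis ..
      qed
      finally show ?thesis using M[OF g] ij jn by simp
    qed
    have Mentry: "M (g \<otimes>\<^bsub>G\<^esub> h) $$ (i,j) =
        (\<Sum>l<k. M g $$ (i,l) * M h $$ (l,j)) + (\<Sum>l<n - k. M g $$ (i,l + k) * M h $$ (l + k,j))"
      if "g \<in> carrier G" "h \<in> carrier G" "i < n" "j < n" for g h i j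
    proof -
      have "M (g \<otimes>\<^bsub>G\<^esub> h) $$ (i,j) = (\<Sum>l<n. M g $$ (i,l) * M h $$ (l,j))"
        using that carrier_matD[OF M[OF that(1)]] carrier_matD[OF M[OF that(2)]]
        by (simp add: Mm scalar_prod_def atLeast0LessThan)
      then show ?thesis by (simp only: sum_lessThan_split[OF kn])
    qed
    define A where "A g = mat k k (\<lambda>(i,j). M g $$ (i,j))" for g
    define D where "D g = mat (n - k) (n - k) (\<lambda>(i,j). M g $$ (i + k,j + k))" for g
    have repA: "representation G k A" unfolding representation_iff[OF G]
    proof (intro conjI ballI)
      fix g h assume gh: "g \<in> carrier G" "h \<in> carrier G"
      show "A (g \<otimes>\<^bsub>G\<^esub> h) = A g * A h"
      proof (rule eq_matI)
        fix i j assume "i < dim_row (A g * A h)" "j < dim_col (A g * A h)"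
        then have ij: "i < k" "j < k" by (auto simp: A_def)
        have "(\<Sum>l<n - k. M g $$ (i,l + k) * M h $$ (l + k,j)) = 0"
          using M0[OF gh(2)] ij by (intro sum.neutral) auto
        then show "A (g \<otimes>\<^bsub>G\<^esub> h) $$ (i,j) = (A g * A h) $$ (i,j)"
          using Mentry[OF gh, of i j] ij k1 by (simp add: A_def scalar_prod_def atLeast0LessThan)
      qed (auto simp: A_def)
    next
      show "A \<one>\<^bsub>G\<^esub> = 1\<^sub>m k" by (rule eq_matI) (use k1 in \<open>auto simp: A_def M1\<close>)
    qed (simp add: A_def)
    have repD: "representation G (n - k) D" unfolding representation_iff[OF G]
    proof (intro conjI ballI)
      fix g h assume gh: "g \<in> carrier G" "h \<in> carrier G"
      show "D (g \<otimes>\<^bsub>G\<^esub> h) = D g * D h"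
      proof (rule eq_matI)
        fix i j assume "i < dim_row (D g * D h)" "j < dim_col (D g * D h)"
        then have ij: "i < n - k" "j < n - k" by (auto simp: D_def)
        have "(\<Sum>l<k. M g $$ (i + k,l) * M h $$ (l,j + k)) = 0"
          using M0[OF gh(1)] ij by (intro sum.neutral) auto
        then show "D (g \<otimes>\<^bsub>G\<^esub> h) $$ (i,j) = (D g * D h) $$ (i,j)"
          using Mentry[OF gh, of "i + k" "j + k"] ij by (simp add: D_def scalar_prod_def atLeast0LessThan)
      qed (auto simp: D_def)
    next
      show "D \<one>\<^bsub>G\<^esub> = 1\<^sub>m (n - k)" by (rule eq_matI) (auto simp: D_def M1)
    qed (simp add: D_def)
    have tr: "mat_trace (\<rho> g) = mat_trace (A g) + mat_trace (D g)" if g: "g \<in> carrier G" for g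
    proof -
      have "mat_trace (\<rho> g) = (\<Sum>i<n. M g $$ (i,i))"
        using carrier_matD(1)[OF M[OF g]] Mtr[OF g] by (simp add: mat_trace_def)
      also have "\<dots> = (\<Sum>i<k. M g $$ (i,i)) + (\<Sum>i<n - k. M g $$ (i + k,i + k))"
        by (rule sum_lessThan_split[OF kn])
      finally show ?thesis by (simp add: mat_trace_def A_def D_def)
    qed
    obtain as where as: "set as \<subseteq> Irr G" "\<forall>g\<in>carrier G. mat_trace (A g) = (\<Sum>\<psi>\<leftarrow>as. \<psi> g)"
      using less.IH[OF k1 repA] by blast
    obtain ds where ds: "set ds \<subseteq> Irr G" "\<forall>g\<in>carrier G. mat_trace (D g) = (\<Sum>\<psi>\<leftarrow>ds. \<psi> g)"
      using less.IH[OF _ repD] k0 k1 by auto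
    show ?thesis by (rule exI[of _ "as @ ds"]) (use as ds tr in auto)
  qed
qed

lemma sum_list_eq_sum_count:
  "(\<Sum>x\<leftarrow>xs. f x) = (\<Sum>x\<in>set xs. of_nat (count_list xs x) * (f x :: complex))"
proof -
  have "(\<Sum>x\<leftarrow>xs. f x) = (\<Sum>x\<in>S. of_nat (count_list xs x) * f x)" if "set xs \<subseteq> S" "finite S" for S
    using that(1)
  proof (induction xs)
    case (Cons a xs)
    have "(\<Sum>x\<in>S. of_nat (count_list (a # xs) x) * f x) =
        (\<Sum>x\<in>S. (if a = x then f a else 0) + of_nat (count_list xs x) * f x)"
      by (intro sum.cong) (auto simp: algebra_simps)
    then show ?case using Cons \<open>finite S\<close> by (simp add: sum.distrib)
  qed simp
  then show ?thesis by simp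
qed

context finite_group
begin

text \<open>The permutation matrices of the left translations, with \<open>G\<close> enumerated by \<open>e\<close>; only the identity
  has fixed points.\<close>
lemma regular_character:
  obtains \<rho> where "representation G (card (carrier G)) \<rho>"
    "\<And>g. g \<in> carrier G \<Longrightarrow> mat_trace (\<rho> g) = (if g = \<one> then of_nat (card (carrier G)) else 0)"
proof -
  define n where "n = card (carrier G)"
  obtain e where e: "bij_betw e {0..<n} (carrier G)"
    using ex_bij_betw_nat_finite[OF finite_carrier] n_def by blast
  have eG: "e i \<in> carrier G" if "i < n" for i using bij_betwE[OF e] that by simp
  have inj: "e i = e j \<longleftrightarrow> i = j" if "i < n" "j < n" for i j
    using e that by (auto simp: bij_betw_def dest: inj_onD)
  have ex: "\<exists>l<n. x = e l" if "x \<in> carrier G" for x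
    using e that unfolding bij_betw_def by (metis atLeastLessThan_iff imageE)
  define \<rho> where "\<rho> g = mat n n (\<lambda>(i,j). if g \<otimes> e j = e i then 1 else 0 :: complex)" for g
  have "representation G n \<rho>" unfolding representation_iff[OF is_group]
  proof (intro conjI ballI)
    fix g h assume gh: "g \<in> carrier G" "h \<in> carrier G"
    show "\<rho> (g \<otimes> h) = \<rho> g * \<rho> h"
    proof (rule eq_matI)
      fix i j assume "i < dim_row (\<rho> g * \<rho> h)" "j < dim_col (\<rho> g * \<rho> h)"
      then have ij: "i < n" "j < n" by (auto simp: \<rho>_def)
      obtain l0 where l0: "l0 < n" "h \<otimes> e j = e l0" using ex[of "h \<otimes> e j"] gh eG ij by auto
      have "(\<rho> g * \<rho> h) $$ (i,j) = (\<Sum>l<n. (if g \<otimes> e l = e i then 1 else 0) * (if h \<otimes> e j = e l then 1 else 0))"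
        using ij by (simp add: \<rho>_def scalar_prod_def atLeast0LessThan)
      also have "\<dots> = (\<Sum>l<n. if l = l0 then (if g \<otimes> e l0 = e i then 1 else 0) else 0)"
        using l0 inj by (intro sum.cong) auto
      also have "\<dots> = (if g \<otimes> e l0 = e i then 1 else 0)" using l0 by simp
      also have "g \<otimes> e l0 = g \<otimes> h \<otimes> e j" using l0 gh eG ij by (simp add: m_assoc)
      finally show "\<rho> (g \<otimes> h) $$ (i,j) = (\<rho> g * \<rho> h) $$ (i,j)" using ij by (simp add: \<rho>_def)
    qed (auto simp: \<rho>_def)
  next
    show "\<rho> \<one> = 1\<^sub>m n" by (rule eq_matI) (use inj eG in \<open>auto simp: \<rho>_def\<close>)
  qed (simp add: \<rho>_def)
  moreover have "mat_trace (\<rho> g) = (if g = \<one> then of_nat n else 0)" if "g \<in> carrier G" for g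
  proof -
    have "mat_trace (\<rho> g) = (\<Sum>i<n. if g = \<one> then 1 else 0)"
      unfolding mat_trace_def \<rho>_def using that eG by (auto intro!: sum.cong)
    then show ?thesis by simp
  qed
  ultimately show thesis using that n_def by blast
qed

text \<open>The regular character is a finite sum of irreducible ones, and its scalar product with \<open>\<chi>\<close> is
  \<open>\<chi>(1)\<close>.  So each \<open>\<chi>\<close> occurs in it exactly \<open>\<chi>(1)\<close> times, which gives finiteness, and evaluation at
  the identity gives the sum of squares.\<close>
lemma shows finite_Irr: "finite (Irr G)"
    and sum_squares_Irr: "(\<Sum>\<chi>\<in>Irr G. (\<chi> \<one>)\<^sup>2) = of_nat (card (carrier G))"
proof -
  let ?n = "of_nat (card (carrier G)) :: complex"
  obtain \<rho> where \<rho>: "representation G (card (carrier G)) \<rho>"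
    and tr: "\<And>g. g \<in> carrier G \<Longrightarrow> mat_trace (\<rho> g) = (if g = \<one> then ?n else 0)"
    using regular_character by blast
  obtain \<psi>s where \<psi>s: "set \<psi>s \<subseteq> Irr G" "\<And>g. g \<in> carrier G \<Longrightarrow> (\<Sum>\<psi>\<leftarrow>\<psi>s. \<psi> g) = (if g = \<one> then ?n else 0)"
    using trace_eq_sum_Irr[OF is_group \<rho>] tr by auto
  have decomp: "(\<Sum>\<psi>\<in>set \<psi>s. of_nat (count_list \<psi>s \<psi>) * \<psi> g) = (if g = \<one> then ?n else 0)"
    if "g \<in> carrier G" for g
    using \<psi>s(2)[OF that] sum_list_eq_sum_count[of "\<lambda>\<psi>. \<psi> g" \<psi>s] by simp
  have mult: "of_nat (count_list \<psi>s \<chi>) = \<chi> \<one>" if \<chi>: "\<chi> \<in> Irr G" for \<chi>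
  proof -
    have "(\<Sum>g\<in>carrier G. \<chi> g * (\<Sum>\<psi>\<in>set \<psi>s. of_nat (count_list \<psi>s \<psi>) * \<psi> (inv g)))
      = (\<Sum>g\<in>carrier G. if g = \<one> then \<chi> \<one> * ?n else 0)"
      by (intro sum.cong) (auto simp: decomp)
    also have "\<dots> = \<chi> \<one> * ?n" using finite_carrier by simp
    finally have 1: "(\<Sum>g\<in>carrier G. \<chi> g * (\<Sum>\<psi>\<in>set \<psi>s. of_nat (count_list \<psi>s \<psi>) * \<psi> (inv g))) = \<chi> \<one> * ?n" .
    have "(\<Sum>g\<in>carrier G. \<chi> g * (\<Sum>\<psi>\<in>set \<psi>s. of_nat (count_list \<psi>s \<psi>) * \<psi> (inv g)))
      = (\<Sum>\<psi>\<in>set \<psi>s. of_nat (count_list \<psi>s \<psi>) * (\<Sum>g\<in>carrier G. \<chi> g * \<psi> (inv g)))"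
      by (simp add: sum_distrib_left mult.left_commute) (rule sum.swap)
    also have "\<dots> = (\<Sum>\<psi>\<in>set \<psi>s. if \<psi> = \<chi> then of_nat (count_list \<psi>s \<chi>) * ?n else 0)"
      using Irr_orthogonal[OF is_group \<chi>] Irr_norm[OF is_group finite_carrier \<chi>] \<psi>s(1)
      by (intro sum.cong) auto
    also have "\<dots> = of_nat (count_list \<psi>s \<chi>) * ?n" by (simp add: count_notin)
    finally show ?thesis using 1 card_carrier_pos by simp
  qed
  have sub: "Irr G \<subseteq> set \<psi>s"
  proof
    fix \<chi> assume \<chi>: "\<chi> \<in> Irr G"
    have "\<chi> \<one> \<noteq> 0" using IrrE[OF \<chi>] by (metis neq0_conv of_nat_eq_0_iff)
    then show "\<chi> \<in> set \<psi>s" using mult[OF \<chi>] by (metis count_notin of_nat_0)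
  qed
  then have eq: "Irr G = set \<psi>s" using \<psi>s(1) by blast
  then show "finite (Irr G)" by simp
  show "(\<Sum>\<chi>\<in>Irr G. (\<chi> \<one>)\<^sup>2) = ?n"
    using decomp[OF one_closed] mult unfolding eq[symmetric] by (simp add: power2_eq_square)
qed

end

section \<open>Characters of quotient groups\<close>

lemma irreducible_representation_comp_surj:
  assumes G: "group G" and H: "group H" and h: "h \<in> hom G H" "h ` carrier G = carrier H"
  shows "irreducible_representation G n (\<lambda>g. \<sigma> (h g)) \<longleftrightarrow> irreducible_representation H n \<sigma>"
proof -
  have h1: "h \<one>\<^bsub>G\<^esub> = \<one>\<^bsub>H\<^esub>" using hom_one[OF h(1) G H] .
  have hm: "h (x \<otimes>\<^bsub>G\<^esub> y) = h x \<otimes>\<^bsub>H\<^esub> h y" if "x \<in> carrier G" "y \<in> carrier G" for x y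
    using h(1) that by (simp add: hom_mult)
  have rep: "representation G n (\<lambda>g. \<sigma> (h g)) \<longleftrightarrow> representation H n \<sigma>"
    unfolding representation_iff[OF G] representation_iff[OF H] h(2)[symmetric] by (simp add: hm h1)
  have "(\<forall>g\<in>carrier G. \<forall>w\<in>W. \<sigma> (h g) *\<^sub>v w \<in> W) \<longleftrightarrow> (\<forall>g\<in>carrier H. \<forall>w\<in>W. \<sigma> g *\<^sub>v w \<in> W)" for W
    unfolding h(2)[symmetric] by simp
  then show ?thesis unfolding irreducible_representation_def rep by simp
qed

context finite_group
begin

lemma finite_group_Mod:
  assumes "N \<lhd> G"
  shows "finite_group (G Mod N)"
  using normal.factorgroup_is_group[OF assms] finite_carrier
  by (auto simp: finite_group_def finite_group_axioms_def carrier_FactGroup)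

text \<open>A representation of \<open>G\<close> that is trivial on \<open>N\<close> is constant on cosets, so it factors through the
  quotient; composition with a surjection does not change the invariant subspaces.\<close>
lemma bij_betw_inflation:
  assumes N: "N \<lhd> G"
  shows "bij_betw (\<lambda>\<psi>. \<lambda>g\<in>carrier G. \<psi> (N #> g)) (Irr (G Mod N)) {\<chi> \<in> Irr G. N \<subseteq> char_ker G \<chi>}"
proof -
  interpret N: normal N G by fact
  have Q: "group (G Mod N)" by (rule N.factorgroup_is_group)
  have sub: "subgroup N G" by (rule N.subgroup_axioms)
  have hom: "(\<lambda>g. N #> g) \<in> hom G (G Mod N)" by (rule N.r_coset_hom_Mod)
  have surj: "(\<lambda>g. N #> g) ` carrier G = carrier (G Mod N)" by (simp add: carrier_FactGroup)
  have mem: "N #> g \<in> carrier (G Mod N)" if "g \<in> carrier G" for g using surj that by blast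
  show ?thesis
  proof (rule bij_betw_imageI)
    show "inj_on (\<lambda>\<psi>. \<lambda>g\<in>carrier G. \<psi> (N #> g)) (Irr (G Mod N))"
    proof (rule inj_onI)
      fix \<psi> \<psi>' assume Irr: "\<psi> \<in> Irr (G Mod N)" "\<psi>' \<in> Irr (G Mod N)"
        and eq: "(\<lambda>g\<in>carrier G. \<psi> (N #> g)) = (\<lambda>g\<in>carrier G. \<psi>' (N #> g))"
      show "\<psi> = \<psi>'"
      proof (rule extensionalityI)
        show "\<psi> \<in> extensional (carrier (G Mod N))" "\<psi>' \<in> extensional (carrier (G Mod N))"
          using Irr by (auto simp: Irr_def afforded_character_def)
        fix C assume "C \<in> carrier (G Mod N)"
        then obtain g where "g \<in> carrier G" "C = N #> g" using surj by blast
        then show "\<psi> C = \<psi>' C" using fun_cong[OF eq, of g] by simp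
      qed
    qed
    show "(\<lambda>\<psi>. \<lambda>g\<in>carrier G. \<psi> (N #> g)) ` Irr (G Mod N) = {\<chi> \<in> Irr G. N \<subseteq> char_ker G \<chi>}"
    proof (intro equalityI subsetI)
      fix \<chi> assume "\<chi> \<in> (\<lambda>\<psi>. \<lambda>g\<in>carrier G. \<psi> (N #> g)) ` Irr (G Mod N)"
      then obtain n \<sigma> where \<sigma>: "irreducible_representation (G Mod N) n \<sigma>"
        and \<chi>: "\<chi> = (\<lambda>g\<in>carrier G. afforded_character (G Mod N) \<sigma> (N #> g))"
        by (auto simp: Irr_def)
      have \<rho>: "irreducible_representation G n (\<lambda>g. \<sigma> (N #> g))"
        using irreducible_representation_comp_surj[OF is_group Q hom surj] \<sigma> by blast
      have aff: "\<chi> = afforded_character G (\<lambda>g. \<sigma> (N #> g))"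
        using mem by (auto simp: \<chi> afforded_character_def fun_eq_iff restrict_def)
      have "\<chi> \<in> Irr G" using \<rho> aff by (auto simp: Irr_def)
      moreover have "N \<subseteq> char_ker G \<chi>"
      proof
        fix x assume x: "x \<in> N"
        then have "N #> x = N #> \<one>" using coset_join2[OF _ sub] N.subset by auto
        then show "x \<in> char_ker G \<chi>" using x N.subset by (auto simp: char_ker_def aff afforded_character_def)
      qed
      ultimately show "\<chi> \<in> {\<chi> \<in> Irr G. N \<subseteq> char_ker G \<chi>}" by simp
    next
      fix \<chi> assume "\<chi> \<in> {\<chi> \<in> Irr G. N \<subseteq> char_ker G \<chi>}"
      then have \<chi>: "\<chi> \<in> Irr G" and ker: "N \<subseteq> char_ker G \<chi>" by auto
      obtain n \<rho> where \<rho>: "irreducible_representation G n \<rho>" "\<chi> = afforded_character G \<rho>"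
        using \<chi> by (auto simp: Irr_def)
      note R = irreducible_representationD[OF is_group \<rho>(1)]
      define \<sigma> where "\<sigma> C = \<rho> (SOME x. x \<in> C)" for C
      have \<sigma>: "\<sigma> (N #> g) = \<rho> g" if g: "g \<in> carrier G" for g
      proof -
        have "(SOME x. x \<in> N #> g) \<in> N #> g" using rcos_self[OF g sub] by (rule someI)
        then obtain x where x: "x \<in> N" "(SOME x. x \<in> N #> g) = x \<otimes> g" by (auto simp: r_coset_def)
        then have "\<rho> x = 1\<^sub>m n" using Irr_ker_iff_one[OF \<rho>(1), of x] ker \<rho>(2) N.subset by auto
        then show ?thesis using x R(4) left_mult_one_mat[OF R(3)[OF g]] g N.subset by (auto simp: \<sigma>_def)
      qed
      have "irreducible_representation G n (\<lambda>g. \<sigma> (N #> g)) \<longleftrightarrow> irreducible_representation G n \<rho>"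
        unfolding irreducible_representation_def representation_iff[OF is_group]
        by (simp add: \<sigma>)
      then have "irreducible_representation (G Mod N) n \<sigma>"
        using irreducible_representation_comp_surj[OF is_group Q hom surj] \<rho>(1) by blast
      then have Irr: "afforded_character (G Mod N) \<sigma> \<in> Irr (G Mod N)" by (auto simp: Irr_def)
      have "\<chi> = (\<lambda>g\<in>carrier G. afforded_character (G Mod N) \<sigma> (N #> g))"
        using mem \<sigma> by (auto simp: \<rho>(2) afforded_character_def fun_eq_iff restrict_def)
      then show "\<chi> \<in> (\<lambda>\<psi>. \<lambda>g\<in>carrier G. \<psi> (N #> g)) ` Irr (G Mod N)"
        using Irr by (rule image_eqI)
    qed
  qed
qed

lemma sum_squares_Irr_over:
  assumes N: "N \<lhd> G"
  shows "(\<Sum>\<chi> | \<chi> \<in> Irr G \<and> N \<subseteq> char_ker G \<chi>. (\<chi> \<one>)\<^sup>2) = of_nat (card (carrier G)) / of_nat (card N)"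
proof -
  interpret N: normal N G by fact
  have sub: "subgroup N G" by (rule N.subgroup_axioms)
  have "(\<Sum>\<psi>\<in>Irr (G Mod N). (\<psi> (N #> \<one>))\<^sup>2) = (\<Sum>\<chi> | \<chi> \<in> Irr G \<and> N \<subseteq> char_ker G \<chi>. (\<chi> \<one>)\<^sup>2)"
    using sum.reindex_bij_betw[OF bij_betw_inflation[OF N], of "\<lambda>\<chi>. (\<chi> \<one>)\<^sup>2"] by simp
  moreover have "N #> \<one> = \<one>\<^bsub>G Mod N\<^esub>" using coset_mult_one[OF N.subset] by simp
  ultimately have "(\<Sum>\<chi> | \<chi> \<in> Irr G \<and> N \<subseteq> char_ker G \<chi>. (\<chi> \<one>)\<^sup>2) = of_nat (card (carrier (G Mod N)))"
    using finite_group.sum_squares_Irr[OF finite_group_Mod[OF N]] by simp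
  moreover have "card (carrier (G Mod N)) * card N = card (carrier G)"
    using lagrange[OF sub] by (simp add: FactGroup_def Coset.order_def)
  then have "of_nat (card (carrier (G Mod N))) * of_nat (card N) = (of_nat (card (carrier G)) :: complex)"
    by (simp only: of_nat_mult[symmetric])
  moreover have "card N \<noteq> 0"
    using finite_subset[OF N.subset finite_carrier] N.one_closed by (metis card_0_eq empty_iff)
  ultimately show ?thesis by (simp add: nonzero_eq_divide_eq)
qed

end

section \<open>Non-linear characters and commutator subgroups\<close>

context finite_group
begin

lemma Irr_degree_ge_1:
  assumes "\<phi> \<in> Irr G"
  shows "Re (\<phi> \<one>) \<ge> 1" "Im (\<phi> \<one>) = 0"
  using IrrE[OF assms] by (metis complex_Re_of_nat One_nat_def Suc_leI of_nat_1 of_nat_le_iff,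
    metis complex_Im_of_nat)

lemma nl_iff_degree_ne_1: "\<phi> \<in> nl G \<longleftrightarrow> \<phi> \<in> Irr G \<and> \<phi> \<one> \<noteq> 1"
  using Irr_degree_ge_1[of \<phi>] by (auto simp: nl_def complex_eq_iff)

lemma nl_iff: "\<phi> \<in> nl G \<longleftrightarrow> \<phi> \<in> Irr G \<and> \<not> derived G (carrier G) \<subseteq> char_ker G \<phi>"
  using nl_iff_degree_ne_1 Irr_linear_iff by auto

lemma mult_cnj_on_char_centre:
  assumes "\<phi> \<in> Irr G" "g \<in> char_centre G \<phi>"
  shows "\<phi> g * cnj (\<phi> g) = (\<phi> \<one>)\<^sup>2"
  using assms by (simp add: char_centre_def complex_norm_square[symmetric])

text \<open>On the centre \<open>\<rho>\<close> acts by scalars \<open>\<phi>(x)/\<phi>(1)\<close>, which multiply.\<close>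
lemma Irr_centre_mult:
  assumes "\<phi> \<in> Irr G" and x: "x \<in> char_centre G \<phi>" and y: "y \<in> char_centre G \<phi>"
  shows "\<phi> (x \<otimes> y) / \<phi> \<one> = (\<phi> x / \<phi> \<one>) * (\<phi> y / \<phi> \<one>)"
proof -
  obtain n \<rho> where \<rho>: "irreducible_representation G n \<rho>" "n > 0" "\<phi> = afforded_character G \<rho>"
    "\<And>g. g \<in> carrier G \<Longrightarrow> \<phi> g = mat_trace (\<rho> g)" "\<phi> \<one> = of_nat n"
    using IrrE[OF assms(1)] by metis
  note R = irreducible_representationD[OF is_group \<rho>(1)]
  have xy: "x \<in> carrier G" "y \<in> carrier G" using x y by (auto simp: char_centre_def)
  obtain c d where cd: "\<rho> x = c \<cdot>\<^sub>m 1\<^sub>m n" "\<rho> y = d \<cdot>\<^sub>m 1\<^sub>m n"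
    using Irr_centre_iff_scalar[OF \<rho>(1)] x y xy \<rho>(3) by blast
  have "\<rho> (x \<otimes> y) = c \<cdot>\<^sub>m (d \<cdot>\<^sub>m 1\<^sub>m n)"
    unfolding R(4)[OF xy] cd by (simp add: mult_smult_assoc_mat[of _ n n _ n])
  then show ?thesis using \<rho>(2) xy cd by (simp add: \<rho>(4,5) mat_trace_def)
qed

lemma normal_commutator_subgroup:
  assumes "H \<lhd> G"
  shows "commutator_subgroup G H (carrier G) \<lhd> G"
proof -
  interpret H: normal H G by fact
  show ?thesis unfolding commutator_subgroup_def
  proof (rule normal_generateI)
    show "{inv h \<otimes> inv k \<otimes> h \<otimes> k |h k. h \<in> H \<and> k \<in> carrier G} \<subseteq> carrier G"
      using H.subset by auto
    fix c x assume "c \<in> {inv h \<otimes> inv k \<otimes> h \<otimes> k |h k. h \<in> H \<and> k \<in> carrier G}" and x: "x \<in> carrier G"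
    then obtain h k where hk: "h \<in> H" "k \<in> carrier G" and c: "c = inv h \<otimes> inv k \<otimes> h \<otimes> k" by blast
    have h: "h \<in> carrier G" using hk H.subset by blast
    have cancel: "inv x \<otimes> (x \<otimes> y) = y" if "y \<in> carrier G" for y
      using x that by (simp add: m_assoc[symmetric])
    have "x \<otimes> c \<otimes> inv x = inv (x \<otimes> h \<otimes> inv x) \<otimes> inv (x \<otimes> k \<otimes> inv x) \<otimes> (x \<otimes> h \<otimes> inv x) \<otimes> (x \<otimes> k \<otimes> inv x)"
      using x h hk by (simp add: c inv_mult_group m_assoc cancel)
    moreover have "x \<otimes> h \<otimes> inv x \<in> H" using H.inv_op_closed2[OF x hk(1)] .
    ultimately show "x \<otimes> c \<otimes> inv x \<in> {inv h \<otimes> inv k \<otimes> h \<otimes> k |h k. h \<in> H \<and> k \<in> carrier G}"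
      using x hk by blast
  qed
qed

lemma commutator_subgroup_subset_derived:
  assumes "H \<subseteq> carrier G"
  shows "commutator_subgroup G H (carrier G) \<subseteq> derived G (carrier G)"
proof -
  have "commutator_subgroup G H (carrier G) \<subseteq> commutator_subgroup G (carrier G) (carrier G)"
    unfolding commutator_subgroup_def using assms by (intro mono_generate) blast
  then show ?thesis using commutator_subgroup_self_eq_derived[OF subgroup_self] by simp
qed

lemma normal_derived: "derived G (carrier G) \<lhd> G"
  by (rule derived_is_normal[OF normal_self])

lemma card_normal_pos: "N \<lhd> G \<Longrightarrow> card N > 0"
  using finite_carrier normal_imp_subgroup[of N G] subgroup.one_closed[of N G] subgroup.subset[of N G]
  by (metis card_gt_0_iff empty_iff finite_subset)

end

section \<open>GVZ-groups with two character degrees\<close>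

text \<open>One of the two degrees is 1, so having two degrees means that non-linear characters have equal
  degrees.\<close>
locale gvz_two_degrees = finite_group +
  fixes \<chi> :: "'a \<Rightarrow> complex"
  assumes vanish: "\<lbrakk>\<phi> \<in> Irr G; g \<in> carrier G; g \<notin> char_centre G \<phi>\<rbrakk> \<Longrightarrow> \<phi> g = 0"
    and equal_degree: "\<lbrakk>\<phi> \<in> nl G; \<psi> \<in> nl G\<rbrakk> \<Longrightarrow> \<phi> \<one> = \<psi> \<one>"
    and \<chi>_nl: "\<chi> \<in> nl G"
begin

abbreviation "Z \<equiv> char_centre G \<chi>"
abbreviation "N \<equiv> commutator_subgroup G Z (carrier G)"
abbreviation "D \<equiv> derived G (carrier G)"

lemma \<chi>_Irr: "\<chi> \<in> Irr G" and nl_Irr: "\<phi> \<in> nl G \<Longrightarrow> \<phi> \<in> Irr G"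
  using \<chi>_nl by (auto simp: nl_def)

lemma nl_degree: "\<phi> \<in> nl G \<Longrightarrow> \<phi> \<one> = \<chi> \<one>"
  using equal_degree \<chi>_nl by blast

lemma degree_nz: "\<phi> \<in> Irr G \<Longrightarrow> \<phi> \<one> \<noteq> 0"
  using Irr_degree_ge_1(1)[of \<phi>] by auto

lemma Z_normal: "Z \<lhd> G" by (rule normal_char_centre[OF \<chi>_Irr])

lemma Z_subset: "Z \<subseteq> carrier G" by (auto simp: char_centre_def)

text \<open>The norm of \<open>\<phi>\<close> is \<open>|G|\<close> by orthogonality, and it is also \<open>|Z(\<phi>)| \<phi>(1)\<^sup>2\<close> because \<open>\<phi>\<close> vanishes
  off its centre and has modulus \<open>\<phi>(1)\<close> on it.\<close>
lemma degree_square: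
  assumes "\<phi> \<in> Irr G"
  shows "(\<phi> \<one>)\<^sup>2 * of_nat (card (char_centre G \<phi>)) = of_nat (card (carrier G))"
proof -
  have "of_nat (card (carrier G)) = (\<Sum>g\<in>carrier G. \<phi> g * \<phi> (inv g))"
    by (rule Irr_norm[OF is_group finite_carrier assms, symmetric])
  also have "\<dots> = (\<Sum>g\<in>char_centre G \<phi>. \<phi> g * \<phi> (inv g))"
    by (rule sum.mono_neutral_right) (use finite_carrier vanish[OF assms] in \<open>auto simp: char_centre_def\<close>)
  also have "\<dots> = (\<Sum>g\<in>char_centre G \<phi>. (\<phi> \<one>)\<^sup>2)"
  proof (rule sum.cong)
    fix g assume g: "g \<in> char_centre G \<phi>"
    then have "g \<in> carrier G" by (simp add: char_centre_def)
    then show "\<phi> g * \<phi> (inv g) = (\<phi> \<one>)\<^sup>2"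
      using Irr_inv_eq_cnj[OF assms] mult_cnj_on_char_centre[OF assms g] by simp
  qed simp
  finally show ?thesis by (simp add: mult.commute)
qed

text \<open>Both centres have index \<open>\<chi>(1)\<^sup>2\<close> in \<open>G\<close>, so an inclusion between them is an equality.\<close>
lemma nl_centre_eq_iff:
  assumes \<phi>: "\<phi> \<in> nl G"
  shows "char_centre G \<phi> = Z \<longleftrightarrow> N \<subseteq> char_ker G \<phi>"
proof -
  have "(\<chi> \<one>)\<^sup>2 * of_nat (card (char_centre G \<phi>)) = (\<chi> \<one>)\<^sup>2 * of_nat (card Z)"
    using degree_square[OF nl_Irr[OF \<phi>]] degree_square[OF \<chi>_Irr] nl_degree[OF \<phi>] by simp
  then have "card Z = card (char_centre G \<phi>)" using degree_nz[OF \<chi>_Irr] by simp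
  moreover have "finite (char_centre G \<phi>)" using finite_carrier by (simp add: char_centre_def)
  ultimately have "Z \<subseteq> char_centre G \<phi> \<longleftrightarrow> char_centre G \<phi> = Z"
    using card_subset_eq by blast
  then show ?thesis using subset_char_centre_iff[OF nl_Irr[OF \<phi>] Z_subset] by simp
qed

text \<open>\<open>H\<close> plays the role of the product \<open>M G'\<close>: the characters over \<open>H\<close> are the linear ones over \<open>M\<close>, so the
  difference of the two sums of squares counts the non-linear characters over \<open>M\<close>, with weight
  \<open>\<chi>(1)\<^sup>2 = |G : Z|\<close> each.\<close>
lemma card_nl_over:
  assumes M: "M \<lhd> G" and H: "H \<lhd> G"
    and MH: "\<And>\<phi>. \<phi> \<in> Irr G \<Longrightarrow> H \<subseteq> char_ker G \<phi> \<longleftrightarrow> M \<subseteq> char_ker G \<phi> \<and> D \<subseteq> char_ker G \<phi>"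
  shows "real (card {\<phi> \<in> nl G. M \<subseteq> char_ker G \<phi>}) =
    real (card Z) * (1 / real (card M) - 1 / real (card H))"
proof -
  let ?A = "{\<phi> \<in> Irr G. M \<subseteq> char_ker G \<phi>}" and ?B = "{\<phi> \<in> Irr G. H \<subseteq> char_ker G \<phi>}"
  let ?C = "{\<phi> \<in> nl G. M \<subseteq> char_ker G \<phi>}"
  let ?n = "of_nat (card (carrier G)) :: complex"
  have fin: "finite ?A" using finite_Irr by simp
  have BA: "?B \<subseteq> ?A" using MH by auto
  have C: "?C = ?A - ?B" using MH nl_iff by auto
  have "(\<Sum>\<phi>\<in>?C. (\<phi> \<one>)\<^sup>2) = ?n / of_nat (card M) - ?n / of_nat (card H)"
    unfolding C using sum_diff[OF fin BA, of "\<lambda>\<phi>. (\<phi> \<one>)\<^sup>2"] sum_squares_Irr_over[OF M] sum_squares_Irr_over[OF H]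
    by simp
  moreover have "(\<Sum>\<phi>\<in>?C. (\<phi> \<one>)\<^sup>2) = (\<Sum>\<phi>\<in>?C. (\<chi> \<one>)\<^sup>2)"
    by (intro sum.cong refl) (auto simp: nl_degree)
  ultimately have "of_nat (card ?C) * (\<chi> \<one>)\<^sup>2 = ?n / of_nat (card M) - ?n / of_nat (card H)"
    by simp
  also have "\<dots> = (\<chi> \<one>)\<^sup>2 * (of_nat (card Z) * (1 / of_nat (card M) - 1 / of_nat (card H)))"
    unfolding degree_square[OF \<chi>_Irr, symmetric] by (simp add: algebra_simps)
  finally have "of_nat (card ?C) = (of_nat (card Z) * (1 / of_nat (card M) - 1 / of_nat (card H)) :: complex)"
    using degree_nz[OF \<chi>_Irr] by simp
  then have "complex_of_real (real (card ?C)) = complex_of_real (real (card Z) * (1 / real (card M) - 1 / real (card H)))"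
    by simp
  then show ?thesis by (simp only: of_real_eq_iff)
qed

text \<open>For \<open>M = Z\<close> the count gives \<open>1 - |Z|/|Z G'| < 1\<close> non-linear characters, hence none, and so
  \<open>|Z G'| = |Z|\<close>.\<close>
lemma derived_subset_centre: "D \<subseteq> Z"
proof -
  define H where "H = generate G (Z \<union> D)"
  have DG: "D \<subseteq> carrier G" by (rule derived_in_carrier) simp
  have H: "H \<lhd> G" unfolding H_def
  proof (rule normal_generateI)
    show "Z \<union> D \<subseteq> carrier G" using DG Z_subset by simp
    fix h g assume "h \<in> Z \<union> D" "g \<in> carrier G"
    then show "g \<otimes> h \<otimes> inv g \<in> Z \<union> D"
      using normal.inv_op_closed2[OF Z_normal] normal.inv_op_closed2[OF normal_derived] by blast
  qed
  have ZDH: "Z \<union> D \<subseteq> H" unfolding H_def by (auto intro: generate.incl)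
  have "H \<subseteq> char_ker G \<phi> \<longleftrightarrow> Z \<subseteq> char_ker G \<phi> \<and> D \<subseteq> char_ker G \<phi>" if "\<phi> \<in> Irr G" for \<phi>
    using ZDH generate_subgroup_incl[OF _ subgroup_char_ker[OF that], of "Z \<union> D"] by (auto simp: H_def)
  note count = card_nl_over[OF Z_normal H this]
  have Zpos: "real (card Z) > 0" and Hpos: "real (card H) > 0" using card_normal_pos Z_normal H by auto
  have c: "real (card {\<phi> \<in> nl G. Z \<subseteq> char_ker G \<phi>}) = 1 - real (card Z) / real (card H)"
    using count Zpos by (simp add: algebra_simps)
  then have "real (card {\<phi> \<in> nl G. Z \<subseteq> char_ker G \<phi>}) < 1" using Zpos Hpos by simp
  then have "real (card {\<phi> \<in> nl G. Z \<subseteq> char_ker G \<phi>}) = 0" by simp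
  then have "card Z = card H" using c Hpos by (simp add: field_simps)
  moreover have "finite H" using finite_carrier normal_imp_subgroup[OF H] subgroup.subset finite_subset by blast
  ultimately have "Z = H" using ZDH card_subset_eq by blast
  then show ?thesis using ZDH by blast
qed

lemma N_normal: "N \<lhd> G" by (rule normal_commutator_subgroup[OF Z_normal])

lemma N_subset_D: "N \<subseteq> D" by (rule commutator_subgroup_subset_derived[OF Z_subset])

definition "nl_centre = {\<phi> \<in> nl G. char_centre G \<phi> = Z}"

lemma nl_centre_eq: "nl_centre = {\<phi> \<in> nl G. N \<subseteq> char_ker G \<phi>}"
  using nl_centre_eq_iff by (auto simp: nl_centre_def)

lemma card_nl_centre: "real (card nl_centre) = real (card Z) * (1 / real (card N) - 1 / real (card D))"
  unfolding nl_centre_eq by (rule card_nl_over[OF N_normal normal_derived]) (use N_subset_D in auto)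

abbreviation "GZ \<equiv> G\<lparr>carrier := Z\<rparr>"

lemma subgroup_Z: "subgroup Z G" by (rule normal_imp_subgroup[OF Z_normal])

lemma finite_group_GZ: "finite_group GZ"
  using subgroup.subgroup_is_group[OF subgroup_Z is_group] finite_subset[OF Z_subset finite_carrier]
  by (simp add: finite_group_def finite_group_axioms_def)

lemma Irr_star_eq: "Irr_star G \<chi> = {\<mu> \<in> Irr GZ. N \<subseteq> char_ker GZ \<mu> \<and> \<not> D \<subseteq> char_ker GZ \<mu>}"
  by (simp add: Irr_star_def Let_def)

text \<open>Since \<open>[Z,Z] \<subseteq> [Z,G]\<close>, all characters of \<open>Z\<close> over \<open>[Z,G]\<close> are linear, and sums of squares are just
  cardinalities.\<close>
lemma card_Irr_star:
  "finite (Irr_star G \<chi>)" "real (card (Irr_star G \<chi>)) = real (card Z) * (1 / real (card N) - 1 / real (card D))"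
proof -
  interpret GZ: finite_group GZ by (rule finite_group_GZ)
  let ?A = "{\<mu> \<in> Irr GZ. N \<subseteq> char_ker GZ \<mu>}" and ?B = "{\<mu> \<in> Irr GZ. D \<subseteq> char_ker GZ \<mu>}"
  have fin: "finite ?A" using GZ.finite_Irr by simp
  have BA: "?B \<subseteq> ?A" using N_subset_D by auto
  have star: "Irr_star G \<chi> = ?A - ?B" by (auto simp: Irr_star_eq)
  show "finite (Irr_star G \<chi>)" unfolding star using fin by simp
  have der: "derived GZ (carrier GZ) \<subseteq> N"
  proof -
    have "derived GZ Z = commutator_subgroup G Z Z"
      using derived_consistent[OF order_refl subgroup_Z] commutator_subgroup_self_eq_derived[OF subgroup_Z] by simp
    also have "\<dots> \<subseteq> N" unfolding commutator_subgroup_def using Z_subset by (intro mono_generate) blast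
    finally show ?thesis by simp
  qed
  have lin: "\<mu> \<one> = 1" if "\<mu> \<in> ?A" for \<mu>
    using GZ.Irr_linear_iff[of \<mu>] that der by auto
  have over: "complex_of_nat (card {\<mu> \<in> Irr GZ. M \<subseteq> char_ker GZ \<mu>}) = of_nat (card Z) / of_nat (card M)"
    if M: "M \<lhd> G" "N \<subseteq> M" "M \<subseteq> Z" for M
  proof -
    have MZ: "M \<lhd> GZ" using normal_restrict_supergroup[OF subgroup_Z M(1) M(3)] .
    have "(\<Sum>\<mu> | \<mu> \<in> Irr GZ \<and> M \<subseteq> char_ker GZ \<mu>. (\<mu> \<one>)\<^sup>2) = (\<Sum>\<mu> | \<mu> \<in> Irr GZ \<and> M \<subseteq> char_ker GZ \<mu>. 1)"
    proof (rule sum.cong)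
      fix \<mu> assume "\<mu> \<in> {\<mu> \<in> Irr GZ. M \<subseteq> char_ker GZ \<mu>}"
      then have "\<mu> \<one> = 1" using M(2) by (intro lin) auto
      then show "(\<mu> \<one>)\<^sup>2 = 1" by simp
    qed simp
    then show ?thesis using GZ.sum_squares_Irr_over[OF MZ] by simp
  qed
  have "card ?B \<le> card ?A" by (rule card_mono[OF fin BA])
  then have "complex_of_nat (card (Irr_star G \<chi>)) = of_nat (card ?A) - of_nat (card ?B)"
    unfolding star using card_Diff_subset[OF finite_subset[OF BA fin] BA] by simp
  also have "\<dots> = of_nat (card Z) / of_nat (card N) - of_nat (card Z) / of_nat (card D)"
    using over[OF N_normal] over[OF normal_derived N_subset_D derived_subset_centre]
      N_subset_D derived_subset_centre by simp
  finally have "complex_of_real (real (card (Irr_star G \<chi>))) =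
      complex_of_real (real (card Z) * (1 / real (card N) - 1 / real (card D)))"
    by (simp add: algebra_simps)
  then show "real (card (Irr_star G \<chi>)) = real (card Z) * (1 / real (card N) - 1 / real (card D))"
    by (simp only: of_real_eq_iff)
qed

definition central_character :: "('a \<Rightarrow> complex) \<Rightarrow> 'a \<Rightarrow> complex" where
  "central_character \<phi> = (\<lambda>z\<in>Z. \<phi> z / \<phi> \<one>)"

text \<open>Injectivity holds because \<open>\<phi>\<close> vanishes off \<open>Z\<close>; surjectivity follows because the two finite sets
  have equally many elements.\<close>
lemma bij_betw_central_character: "bij_betw central_character nl_centre (Irr_star G \<chi>)"
proof -
  interpret GZ: finite_group GZ by (rule finite_group_GZ)
  have sub: "central_character ` nl_centre \<subseteq> Irr_star G \<chi>"
  proof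
    fix \<mu> assume "\<mu> \<in> central_character ` nl_centre"
    then obtain \<phi> where \<phi>: "\<phi> \<in> nl G" "char_centre G \<phi> = Z" and \<mu>: "\<mu> = central_character \<phi>"
      by (auto simp: nl_centre_def)
    note Irr = nl_Irr[OF \<phi>(1)]
    have "(\<lambda>z\<in>carrier GZ. \<phi> z / \<phi> \<one>) \<in> Irr GZ"
      by (rule linear_character_in_Irr[OF GZ.is_group])
        (use Irr_centre_mult[OF Irr] degree_nz[OF Irr] \<phi>(2) in auto)
    then have "\<mu> \<in> Irr GZ" by (simp add: \<mu> central_character_def)
    moreover have "char_ker GZ \<mu> = Z \<inter> char_ker G \<phi>"
      using degree_nz[OF Irr] Z_subset subgroup.one_closed[OF subgroup_Z]
      by (auto simp: char_ker_def \<mu> central_character_def)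
    ultimately show "\<mu> \<in> Irr_star G \<chi>"
      using nl_iff \<phi> nl_centre_eq_iff[OF \<phi>(1)] derived_subset_centre N_subset_D
      by (auto simp: Irr_star_eq)
  qed
  have inj: "inj_on central_character nl_centre"
  proof (rule inj_onI)
    fix \<phi> \<psi> assume \<phi>: "\<phi> \<in> nl_centre" and \<psi>: "\<psi> \<in> nl_centre" and eq: "central_character \<phi> = central_character \<psi>"
    then have \<phi>': "\<phi> \<in> nl G" "char_centre G \<phi> = Z" and \<psi>': "\<psi> \<in> nl G" "char_centre G \<psi> = Z"
      by (auto simp: nl_centre_def)
    show "\<phi> = \<psi>"
    proof (rule extensionalityI)
      show "\<phi> \<in> extensional (carrier G)" "\<psi> \<in> extensional (carrier G)"
        using nl_Irr[OF \<phi>'(1)] nl_Irr[OF \<psi>'(1)] by (auto simp: Irr_def afforded_character_def)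
      fix g assume g: "g \<in> carrier G"
      show "\<phi> g = \<psi> g"
      proof (cases "g \<in> Z")
        case True
        then show ?thesis using fun_cong[OF eq, of g] nl_degree[OF \<phi>'(1)] nl_degree[OF \<psi>'(1)] degree_nz[OF \<chi>_Irr]
          by (simp add: central_character_def)
      next
        case False
        then show ?thesis
          using vanish[OF nl_Irr[OF \<phi>'(1)] g] vanish[OF nl_Irr[OF \<psi>'(1)] g] \<phi>' \<psi>' by simp
      qed
    qed
  qed
  have "card (central_character ` nl_centre) = card (Irr_star G \<chi>)"
    using card_image[OF inj] card_nl_centre card_Irr_star(2) by simp
  then have "central_character ` nl_centre = Irr_star G \<chi>"
    by (rule card_subset_eq[OF card_Irr_star(1) sub])
  then show ?thesis using inj by (simp add: bij_betw_def)
qed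

text \<open>Both sides vanish off the normal subgroup \<open>Z\<close>.  On \<open>Z\<close> the function \<open>\<phi>/\<phi>(1)\<close> is constant on
  conjugates, so the induced value is \<open>|G : Z| \<phi>(g)/\<phi>(1) = \<phi>(1) \<phi>(g)\<close>.\<close>
lemma induced_central_character:
  assumes \<phi>: "\<phi> \<in> nl_centre" and g: "g \<in> carrier G"
  shows "induced_character G Z (central_character \<phi>) g = \<phi> \<one> * \<phi> g"
proof -
  have \<phi>': "\<phi> \<in> nl G" "char_centre G \<phi> = Z" using \<phi> by (auto simp: nl_centre_def)
  note Irr = nl_Irr[OF \<phi>'(1)]
  have conj: "x \<otimes> g \<otimes> inv x \<in> Z \<longleftrightarrow> g \<in> Z" if "x \<in> carrier G" for x
    using Irr_conj_invariant[OF \<chi>_Irr that g] that g by (simp add: char_centre_def)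
  show ?thesis
  proof (cases "g \<in> Z")
    case True
    have "(\<Sum>x | x \<in> carrier G \<and> x \<otimes> g \<otimes> inv x \<in> Z. central_character \<phi> (x \<otimes> g \<otimes> inv x)) =
        (\<Sum>x\<in>carrier G. \<phi> g / \<phi> \<one>)"
      using True conj Irr_conj_invariant[OF Irr _ g] by (intro sum.cong) (auto simp: central_character_def)
    also have "\<dots> = \<phi> \<one> * \<phi> g * of_nat (card Z)"
      using degree_square[OF Irr] degree_nz[OF Irr] \<phi>'(2) by (simp add: power2_eq_square field_simps)
    finally show ?thesis using g card_normal_pos[OF Z_normal] by (simp add: induced_character_def)
  next
    case False
    then have empty: "{x. x \<in> carrier G \<and> x \<otimes> g \<otimes> inv x \<in> Z} = {}" using conj by auto
    have "(\<Sum>x | x \<in> carrier G \<and> x \<otimes> g \<otimes> inv x \<in> Z. central_character \<phi> (x \<otimes> g \<otimes> inv x)) = 0"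
      unfolding empty by simp
    then show ?thesis using g False vanish[OF Irr g] \<phi>'(2) by (simp add: induced_character_def)
  qed
qed

text \<open>The induced character is \<open>\<phi>(1) \<phi>\<close>; any other irreducible \<open>\<psi>\<close> is orthogonal to it, so it has
  multiplicity 0 in every decomposition.\<close>
lemma constituent_of_induced_iff:
  assumes \<phi>: "\<phi> \<in> nl_centre"
  shows "irreducible_constituent G \<psi> (induced_character G Z (central_character \<phi>)) \<longleftrightarrow> \<psi> = \<phi>"
proof
  have Irr: "\<phi> \<in> Irr G" using \<phi> nl_Irr by (auto simp: nl_centre_def)
  note ind = induced_central_character[OF \<phi>]
  note fin = finite_Irr
  let ?n = "of_nat (card (carrier G)) :: complex"
  assume "irreducible_constituent G \<psi> (induced_character G Z (central_character \<phi>))"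
  then obtain m :: "('a \<Rightarrow> complex) \<Rightarrow> nat" where \<psi>: "\<psi> \<in> Irr G" "m \<psi> > 0"
    and m: "\<And>g. g \<in> carrier G \<Longrightarrow> \<phi> \<one> * \<phi> g = (\<Sum>\<theta>\<in>Irr G. of_nat (m \<theta>) * \<theta> g)"
    using ind by (auto simp: irreducible_constituent_def)
  show "\<psi> = \<phi>"
  proof (rule ccontr)
    assume ne: "\<psi> \<noteq> \<phi>"
    have "0 = \<phi> \<one> * (\<Sum>g\<in>carrier G. \<phi> g * \<psi> (inv g))"
      using Irr_orthogonal[OF is_group Irr \<psi>(1)] ne by simp
    also have "\<dots> = (\<Sum>g\<in>carrier G. (\<Sum>\<theta>\<in>Irr G. of_nat (m \<theta>) * \<theta> g) * \<psi> (inv g))"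
      by (simp add: sum_distrib_left mult.assoc[symmetric] m)
    also have "\<dots> = (\<Sum>\<theta>\<in>Irr G. of_nat (m \<theta>) * (\<Sum>g\<in>carrier G. \<theta> g * \<psi> (inv g)))"
      by (simp add: sum_distrib_left sum_distrib_right mult.assoc) (rule sum.swap)
    also have "\<dots> = (\<Sum>\<theta>\<in>Irr G. if \<theta> = \<psi> then of_nat (m \<psi>) * ?n else 0)"
      using Irr_orthogonal[OF is_group _ \<psi>(1)] Irr_norm[OF is_group finite_carrier \<psi>(1)]
      by (intro sum.cong) auto
    also have "\<dots> = of_nat (m \<psi>) * ?n" using fin \<psi>(1) by simp
    finally show False using \<psi>(2) card_carrier_pos by simp
  qed
next
  assume "\<psi> = \<phi>"
  have Irr: "\<phi> \<in> Irr G" using \<phi> nl_Irr by (auto simp: nl_centre_def)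
  obtain n where n: "n > 0" "\<phi> \<one> = of_nat n" using IrrE[OF Irr] by metis
  have "\<phi> \<one> * \<phi> g = (\<Sum>\<theta>\<in>Irr G. of_nat (if \<theta> = \<phi> then n else 0) * \<theta> g)" for g
  proof -
    have "(\<Sum>\<theta>\<in>Irr G. of_nat (if \<theta> = \<phi> then n else 0) * \<theta> g) = (\<Sum>\<theta>\<in>Irr G. if \<theta> = \<phi> then of_nat n * \<phi> g else 0)"
      by (intro sum.cong) auto
    then show ?thesis using Irr finite_Irr n by simp
  qed
  then show "irreducible_constituent G \<psi> (induced_character G Z (central_character \<phi>))"
    unfolding irreducible_constituent_def \<open>\<psi> = \<phi>\<close>
    using Irr n induced_central_character[OF \<phi>]
    by (intro conjI exI[of _ "\<lambda>\<theta>. if \<theta> = \<phi> then n else 0"]) auto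
qed

lemma bij_betw_nl_Mod: "bij_betw (\<lambda>\<psi>. \<lambda>g\<in>carrier G. \<psi> (N #> g)) (nl (G Mod N)) nl_centre"
proof -
  let ?f = "\<lambda>\<psi> :: 'a set \<Rightarrow> complex. \<lambda>g\<in>carrier G. \<psi> (N #> g)"
  note infl = bij_betw_inflation[OF N_normal]
  have N1: "N #> \<one> = \<one>\<^bsub>G Mod N\<^esub>"
    using coset_mult_one normal_imp_subgroup[OF N_normal] subgroup.subset by force
  have degree: "?f \<psi> \<one> = \<psi> \<one>\<^bsub>G Mod N\<^esub>" for \<psi> using N1 by simp
  have "?f ` nl (G Mod N) = nl_centre"
  proof (intro equalityI subsetI)
    fix \<phi> assume "\<phi> \<in> ?f ` nl (G Mod N)"
    then obtain \<psi> where \<psi>: "\<psi> \<in> Irr (G Mod N)" "Re (\<psi> \<one>\<^bsub>G Mod N\<^esub>) > 1" "\<phi> = ?f \<psi>"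
      unfolding nl_def by blast
    then show "\<phi> \<in> nl_centre"
      using bij_betwE[OF infl] degree[of \<psi>] unfolding nl_centre_eq nl_def by auto
  next
    fix \<phi> assume "\<phi> \<in> nl_centre"
    then have \<phi>: "\<phi> \<in> {\<chi> \<in> Irr G. N \<subseteq> char_ker G \<chi>}" "Re (\<phi> \<one>) > 1"
      unfolding nl_centre_eq nl_def by auto
    then obtain \<psi> where \<psi>: "\<psi> \<in> Irr (G Mod N)" "\<phi> = ?f \<psi>"
      using bij_betw_imp_surj_on[OF infl] by blast
    then have "\<psi> \<in> nl (G Mod N)" using \<phi>(2) degree[of \<psi>] unfolding nl_def by simp
    then show "\<phi> \<in> ?f ` nl (G Mod N)" using \<psi>(2) by blast
  qed
  then show ?thesis
    by (intro bij_betw_subset[OF infl]) (auto simp: nl_def)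
qed

end

theorem theorem1p1:
  fixes G :: "('a, 'b) monoid_scheme" and \<chi> :: "'a \<Rightarrow> complex"
  assumes "GVZ_group G" and "card (cd G) = 2" and "\<chi> \<in> nl G"
  shows "real (card {\<phi> \<in> nl G. char_centre G \<phi> = char_centre G \<chi>}) =
           real (card (char_centre G \<chi>)) *
             (1 / real (card (commutator_subgroup G (char_centre G \<chi>) (carrier G)))
              - 1 / real (card (derived G (carrier G)))) \<and>
         (\<forall>\<mu>\<in>Irr_star G \<chi>. \<exists>!\<phi>. \<phi> \<in> nl G \<and>
            irreducible_constituent G \<phi> (induced_character G (char_centre G \<chi>) \<mu>)) \<and>
         (\<exists>f. bij_betw f (Irr_star G \<chi>)
                (nl (G Mod commutator_subgroup G (char_centre G \<chi>) (carrier G)))) \<and>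
         (\<exists>f. bij_betw f (Irr_star G \<chi>)
                {\<phi> \<in> nl G. char_centre G \<phi> = char_centre G \<chi>})"
proof -
  interpret finite_group G
    using assms(1) by (simp add: GVZ_group_def finite_group_def finite_group_axioms_def)
  have "(\<lambda>g\<in>carrier G. 1) \<in> Irr G" by (rule linear_character_in_Irr[OF is_group]) auto
  then have "(\<lambda>g\<in>carrier G. 1) \<one>\<^bsub>G\<^esub> \<in> cd G" unfolding cd_def by blast
  then have "1 \<in> cd G" by simp
  moreover obtain a b where "cd G = {a, b}" using assms(2) by (auto simp: card_2_iff)
  ultimately obtain d where d: "cd G = {1, d}" by (metis insertE insert_commute singletonD)
  have deg: "\<phi> \<one>\<^bsub>G\<^esub> = d" if "\<phi> \<in> nl G" for \<phi>
  proof -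
    have "\<phi> \<in> Irr G" and ne: "\<phi> \<one>\<^bsub>G\<^esub> \<noteq> 1" using that nl_iff_degree_ne_1 by blast+
    then have "\<phi> \<one>\<^bsub>G\<^esub> \<in> cd G" unfolding cd_def by blast
    then show ?thesis using d ne by simp
  qed
  have "gvz_two_degrees G \<chi>"
  proof (intro gvz_two_degrees.intro gvz_two_degrees_axioms.intro)
    show "finite_group G" by (rule finite_group_axioms)
    show "\<chi> \<in> nl G" by (rule assms(3))
    show "\<phi> g = 0" if "\<phi> \<in> Irr G" "g \<in> carrier G" "g \<notin> char_centre G \<phi>" for \<phi> g
    proof -
      have "\<forall>\<chi>\<in>Irr G. \<forall>g\<in>carrier G - char_centre G \<chi>. \<chi> g = 0"
        using assms(1) by (simp add: GVZ_group_def)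
      then show ?thesis using that by simp
    qed
    show "\<phi> \<one>\<^bsub>G\<^esub> = \<psi> \<one>\<^bsub>G\<^esub>" if "\<phi> \<in> nl G" "\<psi> \<in> nl G" for \<phi> \<psi>
      using deg[OF that(1)] deg[OF that(2)] by simp
  qed
  then interpret gvz_two_degrees G \<chi> .
  have star: "\<exists>!\<phi>. \<phi> \<in> nl G \<and> irreducible_constituent G \<phi> (induced_character G Z \<mu>)"
    if "\<mu> \<in> Irr_star G \<chi>" for \<mu>
  proof -
    have "\<mu> \<in> central_character ` nl_centre"
      using that bij_betw_imp_surj_on[OF bij_betw_central_character] by simp
    then obtain \<phi> where \<phi>: "\<mu> = central_character \<phi>" "\<phi> \<in> nl_centre" by (rule imageE)
    show ?thesis unfolding \<phi>(1) constituent_of_induced_iff[OF \<phi>(2)]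
      using \<phi>(2) by (auto simp: nl_centre_def)
  qed
  obtain f where f: "bij_betw f (Irr_star G \<chi>) nl_centre"
    using bij_betw_inv[OF bij_betw_central_character] by blast
  obtain h where h: "bij_betw h nl_centre (nl (G Mod N))"
    using bij_betw_inv[OF bij_betw_nl_Mod] by blast
  show ?thesis
    unfolding nl_centre_def[symmetric]
    using card_nl_centre star exI[where P = "\<lambda>f. bij_betw f _ _", OF f]
      exI[where P = "\<lambda>f. bij_betw f _ _", OF bij_betw_trans[OF f h]] by (intro conjI ballI)
qed

end
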